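(* Let $\sigma_{\max}$ be the largest eigenvalue of the covariance operator $C_{XX}$ of $R_X$. Then for all real $s\ge s'\ge 0$, $$\mathrm{CMMD}_s^2(P_{Y|X},Q_{Z|X})\le \sigma_{\max}^{\,s-s'}\,\mathrm{CMMD}_{s'}^2(P_{Y|X},Q_{Z|X}).$$
   Context: $P$ and $Q$ are probability measures on a measurable space; $X$ takes values in a topological space $\mathcal X$ with its Borel $\sigma$-algebra and $Y,Z$ take values in a measurable space $(\mathcal Y,\mathfrak Y)$. $P_X,Q_X$ are the laws of $X$ under $P,Q$; they have full support and are mutually absolutely continuous. $P_{Y|X}$ is the conditional distribution of $Y$ given $X$ under $P$ and $Q_{Z|X}$ that of $Z$ given $X$ under $Q$; both admit regular versions, represented by equivalence classes (equality for almost every $x$) of Markov kernels. For a fixed $\alpha\in[0,1]$, $R_X=\alpha P_X+(1-\alpha)Q_X$. $k:\mathcal X\times\mathcal X\to\mathbb R$ and $\ell:\mathcal Y\times\mathcal Y\to\mathbb R$ are measurable positive definite kernels with RKHSs $\mathcal H_k$ (separable) and $\mathcal H_\ell$; $k$ is continuous and bounded ($k(x,x)\le k_{\max}$ for all $x$), and $\ell$ is characteristic (mean embeddings of probability measures are injective). $C_{XX}=\mathbb E_{X\sim R_X}[k(\cdot,X)\otimes k(\cdot,X)]$ is the covariance operator of $R_X$ on $\mathcal H_k$, i.e. $\langle f,C_{XX}f'\rangle_{\mathcal H_k}=\mathbb E_{X\sim R_X}[f(X)f'(X)]$. Standing assumption: there is $\gamma\ge\tfrac12$ and Markov kernels $\tilde\kappa_P,\tilde\kappa_Q$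 representing $P_{Y|X},Q_{Z|X}$ such that for every $g\in\mathcal H_\ell$ the maps $x\mapsto\int g\,d\tilde\kappa_P(x,\cdot)$ and $x\mapsto\int g\,d\tilde\kappa_Q(x,\cdot)$ lie in $\mathrm{range}(C_{XX}^\gamma)$. The conditional mean operator $C_{Y|X}:\mathcal H_k\to\mathcal H_\ell$ is the adjoint of $C_{Y|X}^*:\mathcal H_\ell\to\mathcal H_k$, $(C_{Y|X}^*g)(x)=\int g(y)\,\tilde\kappa_P(x,dy)$; $C_{Z|X}$ is defined likewise from $\tilde\kappa_Q$; these are Hilbert–Schmidt operators. Put $\Delta=C_{Y|X}-C_{Z|X}$. For $s\ge0$, $$\mathrm{CMMD}_s^2(P_{Y|X},Q_{Z|X})=\|\Delta C_{XX}^{s/2}\|_{\mathcal H_\ell\otimes\mathcal H_k}^2=\mathrm{Tr}(\Delta^*\Delta C_{XX}^s),$$ where the norm is the Hilbert–Schmidt norm of operators $\mathcal H_k\to\mathcal H_\ell$ and $C_{XX}^0=I$. *)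

theory Defs
  imports "HOL-Probability.Giry_Monad" "HOL-Probability.Conditional_Expectation"
begin

section \<open>Kernels and reproducing kernel Hilbert spaces\<close>

definition positive_definite_kernel :: "('x \<Rightarrow> 'x \<Rightarrow> real) \<Rightarrow> bool" where
  "positive_definite_kernel k \<longleftrightarrow>
     (\<forall>x y. k x y = k y x) \<and>
     (\<forall>S c. finite S \<longrightarrow> 0 \<le> (\<Sum>x\<in>S. \<Sum>y\<in>S. c x * c y * k x y))"

text \<open>
  The RKHS of \<open>k\<close> is a Hilbert space type \<open>'h\<close> (completeness is supplied by the sort of \<open>'h\<close>
  wherever this predicate is used) together with the inclusion \<open>evh\<close> of \<open>'h\<close> into the
  functions on \<open>'x\<close>: \<open>evh f\<close> is the function that the vector \<open>f\<close> stands for.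
\<close>
definition is_rkhs :: "('h::real_inner \<Rightarrow> 'x \<Rightarrow> real) \<Rightarrow> ('x \<Rightarrow> 'x \<Rightarrow> real) \<Rightarrow> bool" where
  "is_rkhs evh k \<longleftrightarrow>
     inj evh \<and>
     (\<forall>x. linear (\<lambda>f. evh f x)) \<and>
     (\<forall>x. \<exists>h. evh h = (\<lambda>x'. k x' x) \<and> (\<forall>f. evh f x = f \<bullet> h))"

text \<open>The canonical feature \<open>k(\<cdot>, x)\<close> as a vector of the RKHS.\<close>
definition feature :: "('h::real_inner \<Rightarrow> 'x \<Rightarrow> real) \<Rightarrow> ('x \<Rightarrow> 'x \<Rightarrow> real) \<Rightarrow> 'x \<Rightarrow> 'h" where
  "feature evh k x = inv evh (\<lambda>x'. k x' x)"

lemma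
  assumes "is_rkhs evh k"
  shows ev_feature: "evh (feature evh k x) x' = k x' x"
    and reproducing: "evh f x = f \<bullet> feature evh k x"
proof -
  from assms obtain h where "inj evh" and h: "evh h = (\<lambda>x'. k x' x)" "\<And>f. evh f x = f \<bullet> h"
    unfolding is_rkhs_def by blast
  have "feature evh k x = h"
    unfolding feature_def h(1)[symmetric] using \<open>inj evh\<close> by (rule inv_f_f)
  then show "evh (feature evh k x) x' = k x' x" and "evh f x = f \<bullet> feature evh k x"
    using h by simp_all
qed

text \<open>
  The mean embedding is taken in the weak sense, so that the Hilbert space need not be separable
  nor the kernel bounded; injectivity is required among the probability measures that have a
  mean embedding.
\<close>
definition is_mean_embedding ::
  "('g::real_inner \<Rightarrow> 'y \<Rightarrow> real) \<Rightarrow> 'y measure \<Rightarrow> 'g \<Rightarrow> bool" where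
  "is_mean_embedding evh \<mu> m \<longleftrightarrow>
     (\<forall>g. integrable \<mu> (evh g) \<and> g \<bullet> m = (LINT y|\<mu>. evh g y))"

definition characteristic_on :: "'y measure \<Rightarrow> ('g::real_inner \<Rightarrow> 'y \<Rightarrow> real) \<Rightarrow> bool" where
  "characteristic_on N evh \<longleftrightarrow>
     (\<forall>\<mu>\<in>space (prob_algebra N). \<forall>\<nu>\<in>space (prob_algebra N). \<forall>m.
        is_mean_embedding evh \<mu> m \<longrightarrow> is_mean_embedding evh \<nu> m \<longrightarrow> \<mu> = \<nu>)"

section \<open>Measures and conditional distributions\<close>

definition full_support :: "'x::topological_space measure \<Rightarrow> bool" where
  "full_support \<mu> \<longleftrightarrow> (\<forall>U. open U \<longrightarrow> U \<noteq> {} \<longrightarrow> emeasure \<mu> U > 0)"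

definition mixture :: "real \<Rightarrow> 'x measure \<Rightarrow> 'x measure \<Rightarrow> 'x measure" where
  "mixture \<alpha> \<mu> \<nu> = measure_of (space \<mu>) (sets \<mu>)
     (\<lambda>A. ennreal \<alpha> * emeasure \<mu> A + ennreal (1 - \<alpha>) * emeasure \<nu> A)"

lemma emeasure_mixture:
  assumes "sets \<nu> = sets \<mu>" and "A \<in> sets \<mu>"
  shows "emeasure (mixture \<alpha> \<mu> \<nu>) A = ennreal \<alpha> * emeasure \<mu> A + ennreal (1 - \<alpha>) * emeasure \<nu> A"
  unfolding mixture_def
proof (rule emeasure_measure_of_sigma)
  show "countably_additive (sets \<mu>) (\<lambda>A. ennreal \<alpha> * emeasure \<mu> A + ennreal (1 - \<alpha>) * emeasure \<nu> A)"
  proof (rule countably_additiveI)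
    fix F :: "nat \<Rightarrow> _"
    assume F: "range F \<subseteq> sets \<mu>" "disjoint_family F"
    have "(\<Sum>i. ennreal \<alpha> * emeasure \<mu> (F i) + ennreal (1 - \<alpha>) * emeasure \<nu> (F i)) =
        ennreal \<alpha> * (\<Sum>i. emeasure \<mu> (F i)) + ennreal (1 - \<alpha>) * (\<Sum>i. emeasure \<nu> (F i))"
      by (simp only: suminf_add[symmetric] ennreal_suminf_cmult summableI)
    also have "(\<Sum>i. emeasure \<mu> (F i)) = emeasure \<mu> (\<Union>i. F i)"
      using F by (rule suminf_emeasure)
    also have "(\<Sum>i. emeasure \<nu> (F i)) = emeasure \<nu> (\<Union>i. F i)"
      using F assms(1) by (intro suminf_emeasure) auto
    finally show "(\<Sum>i. ennreal \<alpha> * emeasure \<mu> (F i) + ennreal (1 - \<alpha>) * emeasure \<nu> (F i)) =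
        ennreal \<alpha> * emeasure \<mu> (\<Union>i. F i) + ennreal (1 - \<alpha>) * emeasure \<nu> (\<Union>i. F i)" .
  qed
qed (use assms in \<open>auto simp: positive_def sets.sigma_algebra_axioms\<close>)

text \<open>
  The Markov kernel \<open>\<kappa>\<close> is a regular version of the conditional distribution of \<open>Y\<close> given \<open>X\<close>
  under \<open>M\<close>: for every measurable \<open>B\<close>, \<open>\<kappa>(X, B) = M(Y \<in> B | \<sigma>(X))\<close> almost surely.
\<close>
definition is_cond_distr ::
  "'w measure \<Rightarrow> ('w \<Rightarrow> 'x::topological_space) \<Rightarrow> 'y measure \<Rightarrow> ('w \<Rightarrow> 'y) \<Rightarrow> ('x \<Rightarrow> 'y measure) \<Rightarrow> bool"
where
  "is_cond_distr M X N Y \<kappa> \<longleftrightarrow>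
     \<kappa> \<in> measurable borel (prob_algebra N) \<and>
     (\<forall>B\<in>sets N. AE \<omega> in M.
        real_cond_exp M (vimage_algebra (space M) X borel) (indicator (Y -` B \<inter> space M)) \<omega>
          = measure (\<kappa> (X \<omega>)) B)"

section \<open>Operators on Hilbert spaces\<close>

definition orthonormal_basis :: "'h::real_inner set \<Rightarrow> bool" where
  "orthonormal_basis B \<longleftrightarrow>
     pairwise orthogonal B \<and> (\<forall>b\<in>B. norm b = 1) \<and> closure (span B) = UNIV"

text \<open>The value does not depend on the orthonormal basis.\<close>
definition hs_norm :: "('h::real_inner \<Rightarrow> 'g::real_inner) \<Rightarrow> real" where
  "hs_norm T = sqrt (\<Sum>\<^sub>\<infinity>b\<in>(SOME B. orthonormal_basis B). (norm (T b))\<^sup>2)"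

definition is_eigenvalue :: "('h::real_vector \<Rightarrow> 'h) \<Rightarrow> real \<Rightarrow> bool" where
  "is_eigenvalue C \<sigma> \<longleftrightarrow> (\<exists>v. v \<noteq> 0 \<and> C v = \<sigma> *\<^sub>R v)"

definition largest_eigenvalue :: "('h::real_vector \<Rightarrow> 'h) \<Rightarrow> real" where
  "largest_eigenvalue C = (GREATEST \<sigma>. is_eigenvalue C \<sigma>)"

definition eigenbasis :: "('h::real_inner \<Rightarrow> 'h) \<Rightarrow> 'h set \<Rightarrow> bool" where
  "eigenbasis C B \<longleftrightarrow> orthonormal_basis B \<and> (\<forall>b\<in>B. \<exists>\<sigma>. C b = \<sigma> *\<^sub>R b)"

text \<open>
  For a compact positive self-adjoint operator \<open>C\<close> with spectral decomposition
  \<open>C = \<Sum>\<^sub>b \<sigma>\<^sub>b b \<otimes> b\<close> over an orthonormal basis of eigenvectors (so \<open>\<sigma>\<^sub>b = b \<bullet> C b\<close>), this is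
  \<open>C\<^sup>r = \<Sum>\<^sub>b \<sigma>\<^sub>b\<^sup>r b \<otimes> b\<close> for \<open>r > 0\<close>, and \<open>C\<^sup>0\<close> is the identity.  The operator does not depend
  on the eigenbasis.  The case \<open>r = 0\<close> is separate because \<open>0 powr 0 = 0\<close>.
\<close>
definition op_powr :: "('h::real_inner \<Rightarrow> 'h) \<Rightarrow> real \<Rightarrow> 'h \<Rightarrow> 'h" where
  "op_powr C r f =
     (if r = 0 then f
      else \<Sum>\<^sub>\<infinity>b\<in>(SOME B. eigenbasis C B). ((b \<bullet> C b) powr r * (b \<bullet> f)) *\<^sub>R b)"

section \<open>Covariance operator, conditional mean operators and CMMD\<close>

text \<open>The Bochner integral of the rank-one operators \<open>k(\<cdot>,x) \<otimes> k(\<cdot>,x)\<close>, evaluated at \<open>f\<close>.\<close>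
definition cov_op ::
  "('h::{real_inner,banach,second_countable_topology} \<Rightarrow> 'x \<Rightarrow> real) \<Rightarrow> ('x \<Rightarrow> 'x \<Rightarrow> real)
    \<Rightarrow> 'x measure \<Rightarrow> 'h \<Rightarrow> 'h"
where
  "cov_op evh k R f = (LINT x|R. (feature evh k x \<bullet> f) *\<^sub>R feature evh k x)"

text \<open>
  \<open>C\<^sup>*g\<close> is the vector of the RKHS on \<open>'x\<close> that stands for the function \<open>x \<mapsto> \<integral> g d\<kappa>(x,\<cdot>)\<close>.
\<close>
definition cond_mean_op_adj ::
  "('h::real_inner \<Rightarrow> 'x \<Rightarrow> real) \<Rightarrow> ('g::real_inner \<Rightarrow> 'y \<Rightarrow> real) \<Rightarrow> ('x \<Rightarrow> 'y measure) \<Rightarrow> 'g \<Rightarrow> 'h"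
where
  "cond_mean_op_adj evk evl \<kappa> g = inv evk (\<lambda>x. LINT y|\<kappa> x. evl g y)"

definition cond_mean_op ::
  "('h::real_inner \<Rightarrow> 'x \<Rightarrow> real) \<Rightarrow> ('g::real_inner \<Rightarrow> 'y \<Rightarrow> real) \<Rightarrow> ('x \<Rightarrow> 'y measure) \<Rightarrow> 'h \<Rightarrow> 'g"
where
  "cond_mean_op evk evl \<kappa> = adjoint (cond_mean_op_adj evk evl \<kappa>)"

text \<open>
  The regularity assumption on a kernel: every \<open>g\<close> in the RKHS on \<open>'y\<close> is integrable under all
  \<open>\<kappa>(x,\<cdot>)\<close> (Bochner integrals of non-integrable functions being \<open>0\<close>), and
  \<open>x \<mapsto> \<integral> g d\<kappa>(x,\<cdot>)\<close> lies in the range of \<open>C\<^sup>\<gamma>\<close>.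
\<close>
definition cond_means_in_range ::
  "('h::real_inner \<Rightarrow> 'x \<Rightarrow> real) \<Rightarrow> ('g::real_inner \<Rightarrow> 'y \<Rightarrow> real) \<Rightarrow> ('x \<Rightarrow> 'y measure)
    \<Rightarrow> ('h \<Rightarrow> 'h) \<Rightarrow> real \<Rightarrow> bool"
where
  "cond_means_in_range evk evl \<kappa> C \<gamma> \<longleftrightarrow>
     (\<forall>g. (\<forall>x. integrable (\<kappa> x) (evl g)) \<and>
          (\<lambda>x. LINT y|\<kappa> x. evl g y) \<in> evk ` range (op_powr C \<gamma>))"

text \<open>
  \<open>CMMD\<^sub>s\<^sup>2\<close>; the conditional distributions enter through the kernels \<open>\<kappa>\<close> and \<open>\<kappa>'\<close>, the
  distribution \<open>R\<^sub>X\<close> through its covariance operator \<open>C\<close>.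
\<close>
definition CMMD_sq ::
  "('h::real_inner \<Rightarrow> 'x \<Rightarrow> real) \<Rightarrow> ('g::real_inner \<Rightarrow> 'y \<Rightarrow> real) \<Rightarrow> ('h \<Rightarrow> 'h)
    \<Rightarrow> ('x \<Rightarrow> 'y measure) \<Rightarrow> ('x \<Rightarrow> 'y measure) \<Rightarrow> real \<Rightarrow> real"
where
  "CMMD_sq evk evl C \<kappa> \<kappa>' s =
     (hs_norm ((\<lambda>f. cond_mean_op evk evl \<kappa> f - cond_mean_op evk evl \<kappa>' f) \<circ> op_powr C (s / 2)))\<^sup>2"

lemma inner_cov_op:
  fixes evh :: "'h::{real_inner,banach,second_countable_topology} \<Rightarrow> 'x::topological_space \<Rightarrow> real"
  assumes rk: "is_rkhs evh k" and cont: "continuous_on UNIV (\<lambda>(x, y). k x y)"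
    and bdd: "\<And>x. k x x \<le> kmax" and "prob_space R" and setsR: "sets R = sets borel"
  shows "f \<bullet> cov_op evh k R f' = (LINT x|R. evh f x * evh f' x)"
proof -
  interpret prob_space R by fact
  let ?\<phi> = "feature evh k"
  have k: "?\<phi> x \<bullet> ?\<phi> y = k x y" for x y
    using ev_feature[OF rk, of y x] reproducing[OF rk, of "?\<phi> y" x] by (simp add: inner_commute)
  have ck: "continuous_on UNIV (\<lambda>x. k (a x) (b x))"
    if "continuous_on UNIV a" "continuous_on UNIV b" for a b :: "'x \<Rightarrow> 'x"
    using continuous_on_compose2[OF cont continuous_on_Pair[OF that]] by simp
  have "continuous_on UNIV ?\<phi>"
    unfolding continuous_on_def
  proof
    fix x
    have d: "dist (?\<phi> y) (?\<phi> x) = sqrt (k y y - 2 * k y x + k x x)" for y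
      by (simp add: dist_norm norm_eq_sqrt_inner inner_diff k inner_commute)
         (simp add: k[symmetric] inner_commute)
    have "continuous_on UNIV (\<lambda>y. sqrt (k y y - 2 * k y x + k x x))"
      by (intro continuous_intros ck)
    from this[unfolded continuous_on_def, rule_format, of x]
    have "((\<lambda>y. dist (?\<phi> y) (?\<phi> x)) \<longlongrightarrow> 0) (at x)"
      unfolding d by simp
    then show "(?\<phi> \<longlongrightarrow> ?\<phi> x) (at x within UNIV)"
      unfolding tendsto_dist_iff[of ?\<phi>] by simp
  qed
  then have m: "?\<phi> \<in> borel_measurable R"
    using borel_measurable_continuous_onI measurable_cong_sets[OF setsR refl] by blast
  have n: "norm (?\<phi> x) \<le> sqrt kmax" for x
    by (simp add: norm_eq_sqrt_inner k bdd)
  have "integrable R (\<lambda>x. (?\<phi> x \<bullet> f') *\<^sub>R ?\<phi> x)"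
  proof (rule integrable_const_bound[where B = "sqrt kmax * norm f' * sqrt kmax"])
    show "AE x in R. norm ((?\<phi> x \<bullet> f') *\<^sub>R ?\<phi> x) \<le> sqrt kmax * norm f' * sqrt kmax"
    proof (rule AE_I2)
      fix x
      have "\<bar>?\<phi> x \<bullet> f'\<bar> \<le> sqrt kmax * norm f'"
        using Cauchy_Schwarz_ineq2[of "?\<phi> x" f'] mult_right_mono[OF n[of x], of "norm f'"] by simp
      then show "norm ((?\<phi> x \<bullet> f') *\<^sub>R ?\<phi> x) \<le> sqrt kmax * norm f' * sqrt kmax"
        unfolding norm_scaleR by (intro mult_mono n) auto
    qed
    show "(\<lambda>x. (?\<phi> x \<bullet> f') *\<^sub>R ?\<phi> x) \<in> borel_measurable R"
      using m by measurable
  qed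
  then have "f \<bullet> cov_op evh k R f' = (LINT x|R. f \<bullet> ((?\<phi> x \<bullet> f') *\<^sub>R ?\<phi> x))"
    unfolding cov_op_def by (intro integral_inner_right[symmetric])
  also have "\<dots> = (LINT x|R. evh f x * evh f' x)"
    by (simp add: reproducing[OF rk] inner_commute mult.commute)
  finally show ?thesis .
qed

end

theory Submission
  imports Defs
begin

text \<open>
  Evaluated on an eigenbasis of \<open>C = C\<^sub>X\<^sub>X\<close> with eigenvalues \<open>\<sigma>\<^sub>b\<close>, \<open>CMMD\<^sub>s\<^sup>2\<close> is
  \<open>\<Sum>\<^sub>b \<sigma>\<^sub>b\<^sup>s \<parallel>\<Delta> b\<parallel>\<^sup>2\<close>, and the claim holds term by term since \<open>0 \<le> \<sigma>\<^sub>b \<le> \<sigma>\<^sub>m\<^sub>a\<^sub>x\<close>.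
  This requires an eigenbasis (\<open>C\<close> is positive with trace at most \<open>sup k(x,x)\<close>, hence compact), the
  independence of the Hilbert--Schmidt norm from the basis, and the convergence of the series also
  for \<open>s = 0\<close>, as a divergent sum would count as \<open>0\<close>.  Convergence comes from the range
  assumption: it makes the vectors \<open>\<sigma>\<^sub>b\<^sup>-\<^sup>\<gamma> C\<^bsub>Y|X\<^esub> b\<close> pointwise bounded as functionals, hence bounded
  in norm, so that \<open>\<parallel>\<Delta> b\<parallel>\<^sup>2\<close> is at most a multiple of \<open>\<sigma>\<^sub>b\<^sup>2\<^sup>\<gamma>\<close>, which is summable as \<open>2\<gamma> \<ge> 1\<close>.
\<close>

subsection \<open>Orthonormal sets in Hilbert spaces\<close>

definition orthonormal :: "'a::real_inner set \<Rightarrow> bool" where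
  "orthonormal B \<longleftrightarrow> pairwise orthogonal B \<and> (\<forall>b\<in>B. norm b = 1)"

lemma orthonormal_basis_iff: "orthonormal_basis B \<longleftrightarrow> orthonormal B \<and> closure (span B) = UNIV"
  by (auto simp: orthonormal_basis_def orthonormal_def)

lemma orthonormal_subset: "orthonormal B \<Longrightarrow> A \<subseteq> B \<Longrightarrow> orthonormal A"
  unfolding orthonormal_def by (meson pairwise_mono subsetD)

lemma orthonormal_inner:
  "orthonormal B \<Longrightarrow> a \<in> B \<Longrightarrow> b \<in> B \<Longrightarrow> a \<bullet> b = (if a = b then 1 else 0)"
  by (auto simp: orthonormal_def pairwise_def orthogonal_def norm_eq_1)

lemma inner_sum_orthonormal:
  assumes "orthonormal B" and "F \<subseteq> B" and "finite F" and "a \<in> B"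
  shows "a \<bullet> (\<Sum>b\<in>F. c b *\<^sub>R b) = (if a \<in> F then c a else 0)"
proof -
  have "a \<bullet> (\<Sum>b\<in>F. c b *\<^sub>R b) = (\<Sum>b\<in>F. if a = b then c b else 0)"
    unfolding inner_sum_right using assms
    by (intro sum.cong refl) (auto simp: orthonormal_inner[OF assms(1)] subsetD)
  then show ?thesis using assms(3) by simp
qed

lemma norm_sum_orthonormal:
  assumes "orthonormal F" and "finite F"
  shows "(norm (\<Sum>b\<in>F. c b *\<^sub>R b))\<^sup>2 = (\<Sum>b\<in>F. (c b)\<^sup>2)"
  unfolding power2_norm_eq_inner
  by (subst inner_sum_left)
     (auto simp: inner_sum_orthonormal[OF assms(1) order_refl assms(2)] power2_eq_square intro!: sum.cong)

text \<open>Completing the square in the coefficients. With \<open>c b = b \<bullet> f\<close> it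
  gives Bessel's inequality; for other \<open>c\<close> it shows that the Fourier coefficients are
  the best choice.\<close>

lemma norm_diff_sum_orthonormal:
  assumes "orthonormal F" and "finite F"
  shows "(norm (f - (\<Sum>b\<in>F. c b *\<^sub>R b)))\<^sup>2 =
    (norm f)\<^sup>2 - (\<Sum>b\<in>F. (b \<bullet> f)\<^sup>2) + (\<Sum>b\<in>F. (c b - b \<bullet> f)\<^sup>2)"
proof -
  have "(norm (f - (\<Sum>b\<in>F. c b *\<^sub>R b)))\<^sup>2 =
      (norm f)\<^sup>2 - 2 * (\<Sum>b\<in>F. c b * (b \<bullet> f)) + (\<Sum>b\<in>F. (c b)\<^sup>2)"
    unfolding norm_sum_orthonormal[OF assms, symmetric] power2_norm_eq_inner
    by (simp add: inner_diff inner_commute inner_sum_right)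
  also have "\<dots> = (norm f)\<^sup>2 - (\<Sum>b\<in>F. (b \<bullet> f)\<^sup>2) + (\<Sum>b\<in>F. (c b - b \<bullet> f)\<^sup>2)"
    by (simp add: power2_diff sum.distrib sum_subtractf sum_distrib_left mult.assoc)
  finally show ?thesis .
qed

lemma Bessel_finite:
  assumes "orthonormal F" and "finite F"
  shows "(\<Sum>b\<in>F. (b \<bullet> f)\<^sup>2) \<le> (norm f)\<^sup>2"
  using norm_diff_sum_orthonormal[OF assms, of f "\<lambda>b. b \<bullet> f"]
    zero_le_power2[of "norm (f - (\<Sum>b\<in>F. (b \<bullet> f) *\<^sub>R b))"] by simp

lemma summable_on_nonneg_real:
  fixes f :: "'a \<Rightarrow> real"
  assumes "\<And>x. x \<in> A \<Longrightarrow> 0 \<le> f x" and "\<And>F. finite F \<Longrightarrow> F \<subseteq> A \<Longrightarrow> sum f F \<le> K"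
  shows "f summable_on A"
  using assms by (intro nonneg_bdd_above_summable_on bdd_aboveI[of _ K]) auto

lemma Bessel_summable:
  assumes "orthonormal B"
  shows "(\<lambda>b. (b \<bullet> f)\<^sup>2) summable_on B"
  using Bessel_finite orthonormal_subset[OF assms]
  by (intro summable_on_nonneg_real[where K = "(norm f)\<^sup>2"]) auto

section \<open>Fourier series along orthonormal sets\<close>

text \<open>The squared norm of a finite sum is the sum of the squared coefficients, so the partial
  sums form a Cauchy net; completeness gives the limit.\<close>

lemma Riesz_Fischer:
  fixes B :: "'a::{real_inner,banach} set"
  assumes B: "orthonormal B" and s: "(\<lambda>b. (c b)\<^sup>2) summable_on B"
  shows "(\<lambda>b. c b *\<^sub>R b) summable_on B"
proof -
  let ?F = "finite_subsets_at_top B" and ?f = "\<lambda>b. c b *\<^sub>R b"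
  have "cauchy_filter (filtermap (sum ?f) ?F)"
    unfolding cauchy_filter_metric_filtermap
  proof (intro allI impI)
    fix e :: real assume "0 < e"
    then have e: "0 < (e / 2)\<^sup>2" by simp
    obtain S where "((\<lambda>b. (c b)\<^sup>2) has_sum S) B" using s by (auto simp: summable_on_def)
    \<comment> \<open>Half of the squared tolerance, because the sums over \<open>G\<close> and
      \<open>F0\<close> are compared through \<open>S\<close>.\<close>
    then have "\<forall>\<^sub>F G in ?F. dist (\<Sum>b\<in>G. (c b)\<^sup>2) S < (e / 2)\<^sup>2 / 2"
      unfolding has_sum_def using e by (intro tendstoD) auto
    then obtain F0 where F0: "finite F0" "F0 \<subseteq> B" and
      tail: "\<forall>G. finite G \<and> F0 \<subseteq> G \<and> G \<subseteq> B \<longrightarrow> dist (\<Sum>b\<in>G. (c b)\<^sup>2) S < (e / 2)\<^sup>2 / 2"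
      unfolding eventually_finite_subsets_at_top by (elim exE conjE) (rule that)
    have near: "dist (sum ?f G) (sum ?f F0) < e / 2" if G: "finite G" "F0 \<subseteq> G" "G \<subseteq> B" for G
    proof -
      have "(dist (sum ?f G) (sum ?f F0))\<^sup>2 = (norm (sum ?f (G - F0)))\<^sup>2"
        using G by (simp add: dist_norm sum_diff F0(1))
      also have "\<dots> = (\<Sum>b\<in>G - F0. (c b)\<^sup>2)"
        using G by (intro norm_sum_orthonormal orthonormal_subset[OF B]) auto
      also have "\<dots> = (\<Sum>b\<in>G. (c b)\<^sup>2) - (\<Sum>b\<in>F0. (c b)\<^sup>2)"
        using G F0(1) by (simp add: sum_diff)
      also have "\<dots> < (e / 2)\<^sup>2"
      proof -
        have "dist (\<Sum>b\<in>G. (c b)\<^sup>2) S < (e / 2)\<^sup>2 / 2" "dist (\<Sum>b\<in>F0. (c b)\<^sup>2) S < (e / 2)\<^sup>2 / 2"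
          using tail G F0 by blast+
        then show ?thesis unfolding dist_real_def by linarith
      qed
      finally show ?thesis by (rule power2_less_imp_less) (use \<open>0 < e\<close> in simp)
    qed
    show "\<exists>P. eventually P ?F \<and> (\<forall>x y. P x \<and> P y \<longrightarrow> dist (sum ?f x) (sum ?f y) < e)"
    proof (intro exI conjI allI impI)
      show "\<forall>\<^sub>F G in ?F. finite G \<and> F0 \<subseteq> G \<and> G \<subseteq> B"
        unfolding eventually_finite_subsets_at_top using F0 by (intro exI[of _ F0]) auto
      fix G G' assume "(finite G \<and> F0 \<subseteq> G \<and> G \<subseteq> B) \<and> finite G' \<and> F0 \<subseteq> G' \<and> G' \<subseteq> B"
      then show "dist (sum ?f G) (sum ?f G') < e"
        using near[of G] near[of G'] dist_triangle_half_r[of "sum ?f F0"] by (simp add: dist_commute)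
    qed
  qed
  then obtain L where "filtermap (sum ?f) ?F \<le> nhds L"
    using convergent_filter_iff_cauchy[of "filtermap (sum ?f) ?F"] 
    by (auto simp: convergent_filter_iff filtermap_bot_iff)
  then show ?thesis
    unfolding summable_on_def has_sum_def filterlim_def by blast
qed

lemma has_sum_inner_left:
  "(f has_sum S) A \<Longrightarrow> ((\<lambda>x. f x \<bullet> g) has_sum (S \<bullet> g)) A"
  by (rule has_sum_bounded_linear[OF bounded_linear_inner_left])

lemma has_sum_inner_right:
  "(f has_sum S) A \<Longrightarrow> ((\<lambda>x. g \<bullet> f x) has_sum (g \<bullet> S)) A"
  by (rule has_sum_bounded_linear[OF bounded_linear_inner_right])

lemma inner_has_sum_orthonormal:
  assumes "orthonormal B" and "((\<lambda>b. c b *\<^sub>R b) has_sum f) B" and "a \<in> B"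
  shows "a \<bullet> f = c a"
proof -
  have "((\<lambda>b. a \<bullet> (c b *\<^sub>R b)) has_sum (a \<bullet> f)) B"
    by (rule has_sum_inner_right[OF assms(2)])
  moreover have "((\<lambda>b. a \<bullet> (c b *\<^sub>R b)) has_sum c a) B"
    using assms by (intro has_sum_finite_neutralI[where B = "{a}"]) (auto simp: orthonormal_inner[OF assms(1)])
  ultimately show ?thesis by (rule has_sum_unique)
qed

text \<open>The Fourier series of \<open>f\<close> has a sum \<open>g\<close> by Riesz-Fischer;
  \<open>f - g\<close> is orthogonal to \<open>B\<close>, hence 0, and \<open>f\<close> is a limit
  of vectors of the span.\<close>

lemma orthonormal_basis_if_total:
  fixes B :: "'a::{real_inner,banach} set"
  assumes B: "orthonormal B" and total: "\<And>v. (\<And>b. b \<in> B \<Longrightarrow> b \<bullet> v = 0) \<Longrightarrow> v = 0"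
  shows "orthonormal_basis B"
  unfolding orthonormal_basis_iff
proof (intro conjI B equalityI subsetI UNIV_I)
  fix f
  obtain g where g: "((\<lambda>b. (b \<bullet> f) *\<^sub>R b) has_sum g) B"
    using Riesz_Fischer[OF B Bessel_summable[OF B]] by (auto simp: summable_on_def)
  have "f - g = 0"
    using inner_has_sum_orthonormal[OF B g] by (intro total) (simp add: inner_diff_right)
  with g have lim: "(sum (\<lambda>b. (b \<bullet> f) *\<^sub>R b) \<longlongrightarrow> f) (finite_subsets_at_top B)"
    by (simp add: has_sum_def)
  show "f \<in> closure (span B)"
  proof (rule Lim_in_closed_set[OF closed_closure _ _ lim])
    show "\<forall>\<^sub>F F in finite_subsets_at_top B. (\<Sum>b\<in>F. (b \<bullet> f) *\<^sub>R b) \<in> closure (span B)"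
      by (intro eventually_finite_subsets_at_top_weakI subsetD[OF closure_subset] span_sum span_scale span_base)
         auto
  qed simp
qed

text \<open>Some \<open>g\<close> in the span is close to \<open>f\<close>. For every
  \<open>F\<close> containing the finitely many basis vectors used by \<open>g\<close>, the Fourier
  sum over \<open>F\<close> is at least as close, being the best approximation in the span of
  \<open>F\<close>.\<close>

lemma orthonormal_expansion:
  assumes "orthonormal_basis B"
  shows "((\<lambda>b. (b \<bullet> f) *\<^sub>R b) has_sum f) B"
  unfolding has_sum_def tendsto_iff
proof (intro allI impI)
  fix e :: real assume "0 < e"
  have B: "orthonormal B" and "f \<in> closure (span B)" using assms by (auto simp: orthonormal_basis_iff)
  then obtain g where "g \<in> span B" and ge: "dist g f < e"
    using \<open>0 < e\<close> by (auto simp: closure_approachable)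
  then obtain t r where t: "finite t" "t \<subseteq> B" and g: "g = (\<Sum>a\<in>t. r a *\<^sub>R a)"
    by (auto simp: span_explicit)
  show "\<forall>\<^sub>F F in finite_subsets_at_top B. dist (\<Sum>b\<in>F. (b \<bullet> f) *\<^sub>R b) f < e"
    unfolding eventually_finite_subsets_at_top
  proof (intro exI[of _ t] conjI allI impI t)
    fix F assume F: "finite F \<and> t \<subseteq> F \<and> F \<subseteq> B"
    let ?c = "\<lambda>b. if b \<in> t then r b else 0"
    have "g = (\<Sum>b\<in>F. ?c b *\<^sub>R b)"
      unfolding g using F by (intro sum.mono_neutral_cong_left) auto
    moreover have "orthonormal F" using F orthonormal_subset[OF B] by blast
    ultimately have "(norm (f - (\<Sum>b\<in>F. (b \<bullet> f) *\<^sub>R b)))\<^sup>2 \<le> (norm (f - g))\<^sup>2"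
      using F by (simp add: norm_diff_sum_orthonormal sum_nonneg)
    then have "norm (f - (\<Sum>b\<in>F. (b \<bullet> f) *\<^sub>R b)) \<le> norm (f - g)"
      by (rule power2_le_imp_le) simp
    then show "dist (\<Sum>b\<in>F. (b \<bullet> f) *\<^sub>R b) f < e"
      using ge by (simp add: dist_norm norm_minus_commute)
  qed
qed

lemma Parseval:
  assumes "orthonormal_basis B"
  shows "((\<lambda>b. (b \<bullet> f) * (b \<bullet> g)) has_sum (f \<bullet> g)) B"
  using has_sum_inner_left[OF orthonormal_expansion[OF assms, of f], of g] by simp

section \<open>Existence of orthonormal bases and the Riesz representation\<close>

text \<open>Zorn's lemma. Closure under scaling suffices to normalise a leftover vector, so
  \<open>S\<close> may also be the set of eigenvectors of an operator, which is in general no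
  subspace.\<close>

lemma maximal_orthonormal_set:
  fixes S :: "'a::real_inner set"
  assumes scale: "\<And>c v. v \<in> S \<Longrightarrow> c *\<^sub>R v \<in> S"
  obtains B where "orthonormal B" and "B \<subseteq> S"
    and "\<And>v. v \<in> S \<Longrightarrow> (\<And>b. b \<in> B \<Longrightarrow> b \<bullet> v = 0) \<Longrightarrow> v = 0"
proof -
  define \<A> where "\<A> = {B. orthonormal B \<and> B \<subseteq> S}"
  have "\<exists>M\<in>\<A>. \<forall>X\<in>\<A>. M \<subseteq> X \<longrightarrow> X = M"
  proof (rule subset_Zorn')
    fix \<C> assume "subset.chain \<A> \<C>"
    then have C: "\<And>B. B \<in> \<C> \<Longrightarrow> orthonormal B \<and> B \<subseteq> S"
      and lin: "\<And>B B'. B \<in> \<C> \<Longrightarrow> B' \<in> \<C> \<Longrightarrow> B \<subseteq> B' \<or> B' \<subseteq> B"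
      unfolding subset.chain_def \<A>_def by blast+
    have "orthogonal a b" if ab: "a \<in> \<Union>\<C>" "b \<in> \<Union>\<C>" "a \<noteq> b" for a b
    proof -
      obtain B where "B \<in> \<C>" "a \<in> B" "b \<in> B" using ab(1,2) lin by blast
      with C[of B] ab(3) show ?thesis by (auto simp: orthonormal_def pairwise_def)
    qed
    moreover have "norm b = 1" "b \<in> S" if "b \<in> \<Union>\<C>" for b
      using that C by (auto simp: orthonormal_def)
    ultimately show "\<Union>\<C> \<in> \<A>"
      unfolding \<A>_def orthonormal_def pairwise_def by blast
  qed
  then obtain B where "B \<in> \<A>" and max: "\<forall>B'\<in>\<A>. B \<subseteq> B' \<longrightarrow> B' = B" by blast
  then have B: "orthonormal B" "B \<subseteq> S" by (auto simp: \<A>_def)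
  show ?thesis
  proof (rule that[OF B], rule ccontr)
    fix v assume v: "v \<in> S" "v \<noteq> 0" and perp: "\<And>b. b \<in> B \<Longrightarrow> b \<bullet> v = 0"
    define u where "u = (1 / norm v) *\<^sub>R v"
    have u: "u \<in> S" "norm u = 1" "\<And>b. b \<in> B \<Longrightarrow> b \<bullet> u = 0"
      using v perp scale by (auto simp: u_def)
    then have "orthonormal (insert u B)"
      using B(1) unfolding orthonormal_def
      by (auto simp: pairwise_insert orthogonal_def inner_commute)
    then have "insert u B \<in> \<A>" using B(2) u(1) by (simp add: \<A>_def)
    then have "u \<in> B" using max by blast
    then show False using u(3)[of u] u(2) by (simp add: norm_eq_1)
  qed
qed

lemma orthonormal_basis_exists:
  obtains B :: "'a::{real_inner,banach} set" where "orthonormal_basis B"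
proof (rule maximal_orthonormal_set[of "UNIV :: 'a set"])
  fix B :: "'a set"
  assume "orthonormal B" and "\<And>v. v \<in> UNIV \<Longrightarrow> (\<And>b. b \<in> B \<Longrightarrow> b \<bullet> v = 0) \<Longrightarrow> v = 0"
  then show thesis using that orthonormal_basis_if_total[of B] by simp
qed simp

text \<open>A maximal orthonormal set \<open>B\<close> in \<open>V\<close> expands every
  \<open>v\<close> in \<open>V\<close>: the Fourier series converges within the closed
  \<open>V\<close>, and the remainder is orthogonal to \<open>B\<close>. So a vector orthogonal to
  \<open>B\<close> is orthogonal to \<open>V\<close>, hence 0, and \<open>B\<close> is a basis of
  the whole space.\<close>

lemma closed_subspace_eq_UNIV:
  fixes V :: "'a::{real_inner,banach} set"
  assumes V: "subspace V" "closed V" and perp: "\<And>u. (\<And>v. v \<in> V \<Longrightarrow> u \<bullet> v = 0) \<Longrightarrow> u = 0"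
  shows "V = UNIV"
proof -
  obtain B where B: "orthonormal B" "B \<subseteq> V"
    and max: "\<And>v. v \<in> V \<Longrightarrow> (\<And>b. b \<in> B \<Longrightarrow> b \<bullet> v = 0) \<Longrightarrow> v = 0"
    using maximal_orthonormal_set[of V] subspace_scale[OF V(1)] by blast
  have sub: "closure (span B) \<subseteq> V"
    using span_minimal[OF B(2) V(1)] V(2) by (rule closure_minimal)
  have "orthonormal_basis B"
  proof (rule orthonormal_basis_if_total[OF B(1)])
    fix u assume u: "\<And>b. b \<in> B \<Longrightarrow> b \<bullet> u = 0"
    show "u = 0"
    proof (rule perp)
      fix v assume "v \<in> V"
      obtain p where p: "((\<lambda>b. (b \<bullet> v) *\<^sub>R b) has_sum p) B"
        using Riesz_Fischer[OF B(1) Bessel_summable[OF B(1)]] by (auto simp: summable_on_def)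
      have "p \<in> V"
      proof (rule Lim_in_closed_set[OF V(2)])
        show "(sum (\<lambda>b. (b \<bullet> v) *\<^sub>R b) \<longlongrightarrow> p) (finite_subsets_at_top B)"
          using p by (simp add: has_sum_def)
        show "\<forall>\<^sub>F F in finite_subsets_at_top B. (\<Sum>b\<in>F. (b \<bullet> v) *\<^sub>R b) \<in> V"
          using B(2) by (intro eventually_finite_subsets_at_top_weakI subspace_sum subspace_scale V) auto
      qed simp
      have pv: "b \<bullet> (v - p) = 0" if "b \<in> B" for b
        using inner_has_sum_orthonormal[OF B(1) p that] by (simp add: inner_diff_right)
      have "v - p = 0"
        using subspace_diff[OF V(1) \<open>v \<in> V\<close> \<open>p \<in> V\<close>] pv by (rule max)
      then have "((\<lambda>b. (b \<bullet> v) *\<^sub>R b) has_sum v) B" using p by simp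
      from has_sum_inner_left[OF this, of u]
      have "((\<lambda>b. 0) has_sum (v \<bullet> u)) B"
        by (rule has_sum_cong[THEN iffD1, rotated]) (simp add: u)
      then show "u \<bullet> v = 0" by (metis has_sum_0_simp has_sum_unique inner_commute)
    qed
  qed
  then show ?thesis using sub by (auto simp: orthonormal_basis_iff)
qed

text \<open>The representing vector is the sum of \<open>\<phi> e *\<^sub>R e\<close> over an
  orthonormal basis.\<close>

lemma Riesz_representation:
  fixes \<phi> :: "'a::{real_inner,banach} \<Rightarrow> real"
  assumes "bounded_linear \<phi>"
  obtains u where "\<And>g. \<phi> g = g \<bullet> u"
proof -
  interpret bounded_linear \<phi> by fact
  obtain K where K: "\<And>x. norm (\<phi> x) \<le> norm x * K" using bounded by blast
  obtain E :: "'a set" where E: "orthonormal_basis E" by (rule orthonormal_basis_exists)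
  then have on: "orthonormal E" by (simp add: orthonormal_basis_iff)
  have "(\<lambda>e. (\<phi> e)\<^sup>2) summable_on E"
  proof (rule summable_on_nonneg_real[where K = "K\<^sup>2"])
    fix F assume F: "finite F" "F \<subseteq> E"
    \<comment> \<open>Evaluating \<phi> at \<open>?g\<close>, whose squared norm is
      \<open>?S\<close>, bounds \<open>?S\<close> by \<open>K * sqrt ?S\<close>.\<close>
    let ?S = "\<Sum>e\<in>F. (\<phi> e)\<^sup>2" and ?g = "\<Sum>e\<in>F. \<phi> e *\<^sub>R e"
    have "?S = \<phi> ?g" by (simp add: sum scaleR power2_eq_square)
    also have "\<dots> \<le> norm ?g * K" using K[of ?g] by simp
    finally have "?S\<^sup>2 \<le> (norm ?g * K)\<^sup>2" by (rule power_mono) (simp add: sum_nonneg)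
    also have "\<dots> = ?S * K\<^sup>2"
      using norm_sum_orthonormal[OF orthonormal_subset[OF on F(2)] F(1), of \<phi>] by (simp add: power_mult_distrib)
    finally have "?S * ?S \<le> ?S * K\<^sup>2" by (simp add: power2_eq_square)
    then show "?S \<le> K\<^sup>2"
      by (smt (verit) mult_le_cancel_left zero_le_power2)
  qed simp
  then obtain u where u: "((\<lambda>e. \<phi> e *\<^sub>R e) has_sum u) E"
    using Riesz_Fischer[OF on] by (auto simp: summable_on_def)
  have "\<phi> g = g \<bullet> u" for g
  proof (rule has_sum_unique)
    show "((\<lambda>e. (e \<bullet> g) * \<phi> e) has_sum \<phi> g) E"
      using has_sum_bounded_linear[OF assms orthonormal_expansion[OF E, of g]] by (simp add: scaleR)
    show "((\<lambda>e. (e \<bullet> g) * \<phi> e) has_sum (g \<bullet> u)) E"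
      using has_sum_inner_right[OF u, of g] by (simp add: inner_commute mult.commute)
  qed
  then show ?thesis by (rule that)
qed

subsection \<open>Uniform boundedness\<close>

text \<open>Baire's theorem: the closed sets \<open>D n\<close> cover the space, so one of them
  contains a ball, which the seminorm laws move to the origin. The form with lower semicontinuous
  seminorms covers the integral of \<open>\<bar>evl g y\<bar>\<close>, whose continuity in
  \<open>g\<close> is not known beforehand.\<close>

lemma uniform_boundedness_seminorms:
  fixes q :: "'i \<Rightarrow> 'a::banach \<Rightarrow> real"
  assumes tri: "\<And>i x y. i \<in> I \<Longrightarrow> q i (x + y) \<le> q i x + q i y"
    and scale: "\<And>i c x. i \<in> I \<Longrightarrow> q i (c *\<^sub>R x) = \<bar>c\<bar> * q i x"
    and lsc: "\<And>i c. i \<in> I \<Longrightarrow> closed {x. q i x \<le> c}"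
    and bdd: "\<And>x. \<exists>K. \<forall>i\<in>I. q i x \<le> K"
  obtains K where "0 \<le> K" and "\<And>i x. i \<in> I \<Longrightarrow> q i x \<le> K * norm x"
proof -
  define D where "D n = {x. \<forall>i\<in>I. q i x \<le> real n}" for n
  have cl: "closed (D n)" for n
  proof -
    have "D n = (\<Inter>i\<in>I. {x. q i x \<le> real n})" by (auto simp: D_def)
    then show ?thesis using lsc by auto
  qed
  have un: "\<Union>(range D) = UNIV"
  proof (intro equalityI subsetI UNIV_I)
    fix x
    obtain K where "\<forall>i\<in>I. q i x \<le> K" using bdd by blast
    then have "x \<in> D (nat \<lceil>K\<rceil>)" unfolding D_def by (auto intro: order_trans[OF _ real_nat_ceiling_ge])
    then show "x \<in> \<Union>(range D)" by blast
  qed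
  have "\<exists>n. interior (D n) \<noteq> {}"
  proof (rule ccontr)
    assume "\<not> ?thesis"
    then have "euclidean interior_of \<Union>(range D) = {}"
      using Met_TC.metric_Baire_category_alt[where \<G> = "range D"] cl
      by (auto simp: complete_UNIV)
    then show False unfolding un by simp
  qed
  then obtain n x0 where "x0 \<in> interior (D n)" by blast
  then obtain r where r: "0 < r" "ball x0 r \<subseteq> D n" by (auto simp: mem_interior)
  have "q i x \<le> (2 * real n / r) * norm x" if i: "i \<in> I" for i x
  proof (cases "x = 0")
    case True
    then show ?thesis using scale[OF i, of 0 0] by simp
  next
    case False
    \<comment> \<open>This makes the displacement \<open>t *\<^sub>R x\<close> have norm
      \<open>r / 2\<close>, so that it stays in the ball in both directions.\<close>
    define t where "t = r / (2 * norm x)"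
    have t: "0 < t" "t * norm x < r" using False r(1) by (auto simp: t_def field_simps)
    define y where "y = t *\<^sub>R x"
    have "x0 + y \<in> ball x0 r" and "x0 - y \<in> ball x0 r"
      using t by (simp_all add: dist_norm y_def)
    then have "x0 + y \<in> D n" and "x0 - y \<in> D n"
      using r(2) by blast+
    then have "q i (x0 + y) \<le> n" and "q i (x0 - y) \<le> n"
      using i by (simp_all add: D_def)
    \<comment> \<open>The centre cancels: 2 y is the difference of \<open>x0 + y\<close> and
      \<open>x0 - y\<close>.\<close>
    moreover have "q i (2 *\<^sub>R y) \<le> q i (x0 + y) + q i ((-1) *\<^sub>R (x0 - y))"
      using tri[OF i, of "x0 + y" "(-1) *\<^sub>R (x0 - y)"] by (simp add: scaleR_2)
    moreover have "q i (2 *\<^sub>R y) = 2 * q i y" and "q i ((-1) *\<^sub>R (x0 - y)) = q i (x0 - y)"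
      using scale[OF i, of 2 y] scale[OF i, of "-1" "x0 - y"] by simp_all
    moreover have "q i y = t * q i x"
      using scale[OF i, of t] t(1) by (simp add: y_def)
    ultimately have "t * q i x \<le> n" by linarith
    then show ?thesis using t(1) r(1) False by (simp add: t_def field_simps)
  qed
  then show ?thesis using r(1) by (intro that[of "2 * real n / r"]) auto
qed

text \<open>Uniform boundedness of the functionals given by the \<open>a i\<close>; taking
  \<open>g = a i\<close> turns it into a bound on norms.\<close>

lemma uniform_boundedness_inner:
  fixes a :: "'i \<Rightarrow> 'a::{real_inner,banach}"
  assumes "\<And>g. \<exists>K. \<forall>i\<in>I. \<bar>a i \<bullet> g\<bar> \<le> K"
  obtains K where "0 \<le> K" and "\<And>i. i \<in> I \<Longrightarrow> norm (a i) \<le> K"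
proof -
  obtain K where K: "0 \<le> K" "\<And>i g. i \<in> I \<Longrightarrow> \<bar>a i \<bullet> g\<bar> \<le> K * norm g"
  proof (rule uniform_boundedness_seminorms[where q = "\<lambda>i g. \<bar>a i \<bullet> g\<bar>" and I = I])
    show "closed {x. \<bar>a i \<bullet> x\<bar> \<le> c}" for i c
      by (intro closed_Collect_le continuous_intros)
  qed (use assms in \<open>auto simp: inner_right_distrib abs_mult\<close>)
  have "norm (a i) \<le> K" if "i \<in> I" for i
  proof (cases "a i = 0")
    case False
    have "norm (a i) * norm (a i) \<le> K * norm (a i)"
      using K(2)[OF that, of "a i"] by (simp add: power2_norm_eq_inner[symmetric] power2_eq_square)
    then show ?thesis using False by simp
  qed (use K in simp)
  then show ?thesis using K(1) by (intro that) auto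
qed

text \<open>The image of the unit ball under \<open>T\<close> is weakly bounded, by
  \<open>norm (S g)\<close> against \<open>g\<close>, hence bounded in norm. Linearity also comes
  from the adjoint identity.\<close>

lemma Hellinger_Toeplitz:
  fixes S :: "'a::{real_inner,banach} \<Rightarrow> 'b::real_inner" and T :: "'b \<Rightarrow> 'a"
  assumes adj: "\<And>x y. S x \<bullet> y = x \<bullet> T y"
  shows "bounded_linear T"
proof -
  obtain K where K: "\<And>y. y \<in> {y. norm y \<le> 1} \<Longrightarrow> norm (T y) \<le> K"
  proof (rule uniform_boundedness_inner[where a = T and I = "{y. norm y \<le> 1}"])
    fix g
    have "\<bar>T y \<bullet> g\<bar> \<le> norm (S g)" if "norm y \<le> 1" for y
      using Cauchy_Schwarz_ineq2[of "S g" y] mult_left_mono[OF that, of "norm (S g)"]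
      by (simp add: adj inner_commute[of "T y"])
    then show "\<exists>K. \<forall>y\<in>{y. norm y \<le> 1}. \<bar>T y \<bullet> g\<bar> \<le> K" by blast
  qed blast
  have lin: "linear T"
  proof (rule linearI)
    fix x y :: 'b and c :: real
    show "T (x + y) = T x + T y"
      by (rule vector_eq_ldot[THEN iffD1]) (simp add: adj[symmetric] inner_right_distrib)
    show "T (c *\<^sub>R x) = c *\<^sub>R T x"
      by (rule vector_eq_ldot[THEN iffD1]) (simp add: adj[symmetric])
  qed
  show ?thesis
  proof (rule bounded_linear_intro[where K = K])
    fix y :: 'b
    show "norm (T y) \<le> norm y * K"
    proof (cases "y = 0")
      case False
      have "norm (T ((1 / norm y) *\<^sub>R y)) \<le> K" using False by (intro K) simp
      then show ?thesis using False by (simp add: linear_scale[OF lin] field_simps)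
    qed (simp add: linear_0[OF lin])
  qed (simp_all add: linear_add[OF lin] linear_scale[OF lin])
qed

subsection \<open>Hilbert--Schmidt norms\<close>

lemma has_sum_sum_swap:
  fixes f :: "'i \<Rightarrow> 'a \<Rightarrow> 'b::topological_comm_monoid_add"
  assumes "finite F" and "\<And>i. i \<in> F \<Longrightarrow> (f i has_sum S i) A"
  shows "((\<lambda>x. \<Sum>i\<in>F. f i x) has_sum (\<Sum>i\<in>F. S i)) A"
  using assms by (induction F) (auto intro!: has_sum_add)

text \<open>
  With \<open>P\<^sub>F\<close> the orthogonal projection onto the span of \<open>F\<close>, the right-hand side minus the left-hand
  side is \<open>\<Sum>\<^sub>e \<parallel>T e - T P\<^sub>F e\<parallel>\<^sup>2\<close>.
\<close>
lemma hs_sum_le: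
  fixes T :: "'a::real_inner \<Rightarrow> 'b::real_inner"
  assumes T: "bounded_linear T" and B: "orthonormal_basis B" and F: "finite F" "orthonormal F"
    and S: "((\<lambda>e. (norm (T e))\<^sup>2) has_sum S) B"
  shows "(\<Sum>b\<in>F. (norm (T b))\<^sup>2) \<le> S"
proof -
  interpret bounded_linear T by fact
  \<comment> \<open>\<open>P e\<close> is \<open>T\<close> applied to the projection of
    \<open>e\<close> onto the span of \<open>F\<close>.\<close>
  define P where "P e = (\<Sum>b\<in>F. (b \<bullet> e) *\<^sub>R T b)" for e
  define S' where "S' = (\<Sum>b\<in>F. (norm (T b))\<^sup>2)"
  have TP: "((\<lambda>e. T e \<bullet> P e) has_sum S') B"
  proof -
    have "((\<lambda>e. (b \<bullet> e) * (T e \<bullet> T b)) has_sum (norm (T b))\<^sup>2) B" for b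
    proof -
      have "((\<lambda>e. (e \<bullet> b) *\<^sub>R T e) has_sum T b) B"
        using has_sum_bounded_linear[OF T orthonormal_expansion[OF B, of b]] by (simp add: scaleR)
      from has_sum_inner_left[OF this, of "T b"] show ?thesis
        by (simp add: inner_commute[of b] power2_norm_eq_inner)
    qed
    then show ?thesis
      unfolding P_def S'_def inner_sum_right inner_scaleR_right by (intro has_sum_sum_swap F(1))
  qed
  \<comment> \<open>Summing over \<open>e\<close> by Parseval leaves the products
    \<open>b \<bullet> b'\<close>, which vanish off the diagonal.\<close>
  have PP: "((\<lambda>e. P e \<bullet> P e) has_sum S') B"
  proof -
    have "((\<lambda>e. P e \<bullet> P e) has_sum (\<Sum>b\<in>F. \<Sum>b'\<in>F. (b \<bullet> b') * (T b' \<bullet> T b))) B"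
    proof -
      have "((\<lambda>e. \<Sum>b\<in>F. \<Sum>b'\<in>F. (e \<bullet> b) * (e \<bullet> b') * (T b' \<bullet> T b))
          has_sum (\<Sum>b\<in>F. \<Sum>b'\<in>F. (b \<bullet> b') * (T b' \<bullet> T b))) B"
        by (intro has_sum_sum_swap F(1) has_sum_cmult_left Parseval[OF B])
      moreover have "P e \<bullet> P e = (\<Sum>b\<in>F. \<Sum>b'\<in>F. (e \<bullet> b) * (e \<bullet> b') * (T b' \<bullet> T b))" for e
        unfolding P_def inner_sum_left inner_sum_right
        by (simp add: inner_commute[of e] mult.assoc)
      ultimately show ?thesis by simp
    qed
    also have "(\<Sum>b\<in>F. \<Sum>b'\<in>F. (b \<bullet> b') * (T b' \<bullet> T b)) = S'"
      unfolding S'_def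
    proof (rule sum.cong[OF refl])
      fix b assume b: "b \<in> F"
      have "(\<Sum>b'\<in>F. (b \<bullet> b') * (T b' \<bullet> T b)) = (\<Sum>b'\<in>F. if b = b' then T b' \<bullet> T b else 0)"
        using b by (intro sum.cong refl) (simp add: orthonormal_inner[OF F(2)])
      then show "(\<Sum>b'\<in>F. (b \<bullet> b') * (T b' \<bullet> T b)) = (norm (T b))\<^sup>2"
        using F(1) b by (simp add: power2_norm_eq_inner)
    qed
    finally show ?thesis .
  qed
  have "((\<lambda>e. (norm (T e))\<^sup>2 + (- 2 * (T e \<bullet> P e) + P e \<bullet> P e)) has_sum (S + (- 2 * S' + S'))) B"
    by (intro has_sum_add S PP has_sum_cmult_right TP)
  then have "0 \<le> S + (- 2 * S' + S')"
  proof (rule has_sum_nonneg)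
    fix e
    have "(norm (T e))\<^sup>2 + (- 2 * (T e \<bullet> P e) + P e \<bullet> P e) = (norm (T e - P e))\<^sup>2"
      by (simp add: power2_norm_eq_inner inner_diff inner_commute)
    then show "0 \<le> (norm (T e))\<^sup>2 + (- 2 * (T e \<bullet> P e) + P e \<bullet> P e)" by simp
  qed
  then show ?thesis by (simp add: S'_def)
qed

text \<open>Finite sums over either basis are bounded by the total over the other. This also gives
  summability over the basis picked by \<open>SOME\<close>, so that the \<open>infsum\<close> in
  \<open>hs_norm\<close> is not the default 0.\<close>

lemma hs_norm_sq_eq:
  fixes T :: "'a::real_inner \<Rightarrow> 'b::real_inner"
  assumes T: "bounded_linear T" and B: "orthonormal_basis B"
    and s: "(\<lambda>b. (norm (T b))\<^sup>2) summable_on B"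
  shows "(hs_norm T)\<^sup>2 = (\<Sum>\<^sub>\<infinity>b\<in>B. (norm (T b))\<^sup>2)"
proof -
  define B0 where "B0 = (SOME B. orthonormal_basis (B :: 'a set))"
  have B0: "orthonormal_basis B0"
    unfolding B0_def using B by (rule someI)
  let ?f = "\<lambda>b. (norm (T b))\<^sup>2"
  have on: "orthonormal F" if "F \<subseteq> B \<or> F \<subseteq> B0" for F
    using that B B0 orthonormal_subset unfolding orthonormal_basis_iff by blast
  have le: "sum ?f F \<le> infsum ?f B" if "finite F" "F \<subseteq> B0" for F
    using that s on by (intro hs_sum_le[OF T B]) auto
  then have s0: "?f summable_on B0"
    by (intro summable_on_nonneg_real) auto
  have "infsum ?f B0 = infsum ?f B"
  proof (rule antisym)
    show "infsum ?f B0 \<le> infsum ?f B"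
      using s0 le by (rule infsum_le_finite_sums)
    show "infsum ?f B \<le> infsum ?f B0"
      using s by (rule infsum_le_finite_sums) (use s0 on in \<open>auto intro!: hs_sum_le[OF T B0]\<close>)
  qed
  moreover have "0 \<le> infsum ?f B0" by (simp add: infsum_nonneg)
  ultimately show ?thesis unfolding hs_norm_def B0_def[symmetric] by simp
qed

subsection \<open>Positive trace-class operators\<close>

text \<open>\<open>GREATEST\<close> is meaningful only if a maximum is attained; \<open>m\<close>
  witnesses this.\<close>

lemma is_eigenvalue_le_largest:
  assumes "is_eigenvalue C m" and "\<And>\<sigma>. is_eigenvalue C \<sigma> \<Longrightarrow> \<sigma> \<le> m" and "is_eigenvalue C \<sigma>"
  shows "\<sigma> \<le> largest_eigenvalue C"
  using assms unfolding largest_eigenvalue_def by (metis Greatest_equality)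

text \<open>Each new index adds a segment, and sums of compact sets are compact. These sets
  approximate the image of the unit ball under a Hilbert-Schmidt operator.\<close>

lemma compact_bounded_combinations:
  fixes x :: "'i \<Rightarrow> 'a::real_normed_vector"
  assumes "finite F"
  shows "compact {\<Sum>e\<in>F. c e *\<^sub>R x e | c. \<forall>e. \<bar>c e\<bar> \<le> (1::real)}"
  using assms
proof (induction F)
  case empty
  have "{\<Sum>e\<in>{}. c e *\<^sub>R x e | c. \<forall>e. \<bar>c e\<bar> \<le> (1::real)} = {0}"
    by (auto intro: exI[of _ "\<lambda>_. 0"])
  then show ?case by simp
next
  case (insert a F)
  let ?K = "\<lambda>F. {\<Sum>e\<in>F. c e *\<^sub>R x e | c. \<forall>e. \<bar>c e\<bar> \<le> (1::real)}"
  have "compact ((\<lambda>t. t *\<^sub>R x a) ` {-1..1})"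
    by (intro compact_continuous_image continuous_intros) auto
  from compact_sums[OF this insert.IH]
  have "compact {u + v |u v. u \<in> (\<lambda>t. t *\<^sub>R x a) ` {-1..1} \<and> v \<in> ?K F}" .
  also have "{u + v |u v. u \<in> (\<lambda>t. t *\<^sub>R x a) ` {-1..1} \<and> v \<in> ?K F} = ?K (insert a F)"
  proof (intro equalityI subsetI)
    fix z assume "z \<in> {u + v |u v. u \<in> (\<lambda>t. t *\<^sub>R x a) ` {-1..1} \<and> v \<in> ?K F}"
    then obtain t c where tc: "-1 \<le> t" "t \<le> 1" "\<forall>e. \<bar>c e\<bar> \<le> (1::real)"
      and z: "z = t *\<^sub>R x a + (\<Sum>e\<in>F. c e *\<^sub>R x e)" by auto
    let ?c = "c(a := t)"
    have "(\<Sum>e\<in>F. ?c e *\<^sub>R x e) = (\<Sum>e\<in>F. c e *\<^sub>R x e)"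
      using insert.hyps by (intro sum.cong) auto
    then have "z = (\<Sum>e\<in>insert a F. ?c e *\<^sub>R x e)"
      using insert.hyps z by simp
    moreover have "\<forall>e. \<bar>?c e\<bar> \<le> 1" using tc by auto
    ultimately show "z \<in> ?K (insert a F)" by blast
  next
    fix z assume "z \<in> ?K (insert a F)"
    then obtain c where c: "\<forall>e. \<bar>c e\<bar> \<le> (1::real)" and z: "z = (\<Sum>e\<in>insert a F. c e *\<^sub>R x e)" by blast
    have "-1 \<le> c a" "c a \<le> 1" using c[rule_format, of a] by auto
    moreover have "z = c a *\<^sub>R x a + (\<Sum>e\<in>F. c e *\<^sub>R x e)" using z insert.hyps by simp
    ultimately show "z \<in> {u + v |u v. u \<in> (\<lambda>t. t *\<^sub>R x a) ` {-1..1} \<and> v \<in> ?K F}"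
      using c by fastforce
  qed
  finally show ?case .
qed

text \<open>The trace condition bounds all partial traces over finite orthonormal sets, so it can be
  stated before any basis is chosen; \<open>K\<close> bounds each eigenvalue as well.\<close>

locale positive_trace_class =
  fixes C :: "'a::{real_inner,banach} \<Rightarrow> 'a" and K :: real
  assumes bounded_linear: "bounded_linear C"
    and self_adjoint: "C f \<bullet> g = f \<bullet> C g"
    and positive: "0 \<le> f \<bullet> C f"
    and trace_le: "finite F \<Longrightarrow> orthonormal F \<Longrightarrow> (\<Sum>b\<in>F. b \<bullet> C b) \<le> K"
begin

sublocale C: bounded_linear C by (rule bounded_linear)

text \<open>Positivity of the form at \<open>f - (1 / m) *\<^sub>R C f\<close>. The bound by
  \<open>m\<close> is asked only at the vector \<open>C f\<close>, so \<open>m\<close> may be a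
  bound valid on an invariant subspace.\<close>

lemma norm_sq_le:
  assumes "0 < m" and "C f \<bullet> C (C f) \<le> m * (norm (C f))\<^sup>2"
  shows "(norm (C f))\<^sup>2 \<le> m * (f \<bullet> C f)"
proof -
  let ?t = "1 / m"
  have adj: "f \<bullet> C (C f) = C f \<bullet> C f" by (simp add: self_adjoint[symmetric])
  have "0 \<le> (f - ?t *\<^sub>R C f) \<bullet> C (f - ?t *\<^sub>R C f)" by (rule positive)
  also have "\<dots> = f \<bullet> C f - 2 * ?t * (norm (C f))\<^sup>2 + ?t\<^sup>2 * (C f \<bullet> C (C f))"
    using assms(1)
    by (simp add: C.diff C.scaleR inner_diff adj power2_norm_eq_inner power2_eq_square[of "1 / m"])
       (simp add: field_simps)
  also have "\<dots> \<le> f \<bullet> C f - 2 * ?t * (norm (C f))\<^sup>2 + ?t\<^sup>2 * (m * (norm (C f))\<^sup>2)"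
    using assms(2) by (intro add_mono mult_left_mono) auto
  also have "\<dots> = f \<bullet> C f - (norm (C f))\<^sup>2 / m"
    using assms(1) by (simp add: power2_eq_square)
  finally show ?thesis using assms(1) by (simp add: field_simps)
qed

section \<open>Compactness and the spectral theorem\<close>

text \<open>\<open>C\<close> is Hilbert-Schmidt, since \<open>(norm (C e))\<^sup>2\<close> is at
  most a multiple of \<open>e \<bullet> C e\<close>. By Cauchy-Schwarz one finite \<open>F\<close>
  then approximates \<open>C f\<close> uniformly over the unit ball, whose image is therefore
  totally bounded.\<close>

lemma compact_image:
  assumes "\<And>n. norm (v n) \<le> 1"
  obtains l r where "strict_mono (r :: nat \<Rightarrow> nat)" and "(\<lambda>n. C (v (r n))) \<longlonglongrightarrow> l"
proof -
  obtain E :: "'a set" where E: "orthonormal_basis E" by (rule orthonormal_basis_exists)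
  then have onE: "orthonormal E" by (simp add: orthonormal_basis_iff)
  obtain M where M: "0 < M" "\<And>x. norm (C x) \<le> norm x * M" using C.pos_bounded by blast
  have CC: "C f \<bullet> C (C f) \<le> M * (norm (C f))\<^sup>2" for f
    using norm_cauchy_schwarz[of "C f" "C (C f)"] mult_left_mono[OF M(2)[of "C f"], of "norm (C f)"]
    by (simp add: power2_eq_square mult.commute mult.left_commute)
  have "(\<Sum>e\<in>F. (norm (C e))\<^sup>2) \<le> M * K" if "finite F" "F \<subseteq> E" for F
  proof -
    have "(\<Sum>e\<in>F. (norm (C e))\<^sup>2) \<le> (\<Sum>e\<in>F. M * (e \<bullet> C e))"
      by (intro sum_mono norm_sq_le M CC)
    also have "\<dots> \<le> M * K"
      unfolding sum_distrib_left[symmetric] using that M(1)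
      by (intro mult_left_mono trace_le orthonormal_subset[OF onE]) auto
    finally show ?thesis .
  qed
  then have "(\<lambda>e. (norm (C e))\<^sup>2) summable_on E"
    by (intro summable_on_nonneg_real) auto
  then obtain S where S: "((\<lambda>e. (norm (C e))\<^sup>2) has_sum S) E" by (auto simp: summable_on_def)
  let ?W = "C ` cball 0 1"
  have "compact (closure ?W)"
    unfolding compact_eq_totally_bounded
  proof (intro conjI allI impI)
    show "complete (closure ?W)" by (simp add: complete_eq_closed)
    fix \<epsilon> :: real assume "0 < \<epsilon>"
    \<comment> \<open>One \<delta> pays for the tail outside \<open>F\<close>, one for the finite
      net; the slack turns closed balls into open ones.\<close>
    define \<delta> where "\<delta> = \<epsilon> / 4"
    have \<delta>: "0 < \<delta>" using \<open>0 < \<epsilon>\<close> by (simp add: \<delta>_def)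
    obtain F where F: "finite F" "F \<subseteq> E" "dist (\<Sum>e\<in>F. (norm (C e))\<^sup>2) S \<le> \<delta>\<^sup>2"
      using has_sum_finite_approximation[OF S, of "\<delta>\<^sup>2"] \<delta> by auto
    let ?K = "{\<Sum>e\<in>F. c e *\<^sub>R C e | c. \<forall>e. \<bar>c e\<bar> \<le> (1::real)}"
    obtain k where k: "finite k" "?K \<subseteq> (\<Union>x\<in>k. ball x \<delta>)"
      using compact_bounded_combinations[OF F(1), of C] \<delta> unfolding compact_eq_totally_bounded by blast
    have "C f \<in> (\<Union>x\<in>k. cball x (2 * \<delta>))" if f: "norm f \<le> 1" for f
    proof -
      let ?s = "\<lambda>G. \<Sum>e\<in>G. (e \<bullet> f) *\<^sub>R C e"
      have near: "dist (?s G) (?s F) \<le> \<delta>" if G: "finite G" "F \<subseteq> G" "G \<subseteq> E" for G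
      proof -
        have on: "orthonormal (G - F)" using G by (intro orthonormal_subset[OF onE]) auto
        have "dist (?s G) (?s F) = norm (?s (G - F))"
          using G F(1) by (simp add: dist_norm sum_diff)
        also have "\<dots> \<le> (\<Sum>e\<in>G - F. \<bar>e \<bullet> f\<bar> * norm (C e))"
          by (rule sum_norm_le) simp
        finally have "(dist (?s G) (?s F))\<^sup>2 \<le> (\<Sum>e\<in>G - F. \<bar>e \<bullet> f\<bar> * norm (C e))\<^sup>2"
          by (rule power_mono) simp
        also have "\<dots> \<le> (\<Sum>e\<in>G - F. \<bar>e \<bullet> f\<bar>\<^sup>2) * (\<Sum>e\<in>G - F. (norm (C e))\<^sup>2)"
          by (rule Cauchy_Schwarz_ineq_sum)
        also have "\<dots> \<le> 1 * \<delta>\<^sup>2"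
        proof (intro mult_mono)
          have "(\<Sum>e\<in>G - F. \<bar>e \<bullet> f\<bar>\<^sup>2) \<le> (norm f)\<^sup>2"
            using Bessel_finite[OF on, of f] G by simp
          also have "\<dots> \<le> 1" using f by (simp add: power_le_one)
          finally show "(\<Sum>e\<in>G - F. \<bar>e \<bullet> f\<bar>\<^sup>2) \<le> 1" .
          have "(\<Sum>e\<in>G. (norm (C e))\<^sup>2) \<le> S"
            using finite_sum_le_has_sum[OF S G(1,3)] by simp
          then show "(\<Sum>e\<in>G - F. (norm (C e))\<^sup>2) \<le> \<delta>\<^sup>2"
            using F(3) G F(1) by (simp add: sum_diff dist_real_def)
        qed (auto intro: sum_nonneg)
        finally show ?thesis using \<delta> by (simp add: power2_le_iff_abs_le)
      qed
      have "((\<lambda>e. (e \<bullet> f) *\<^sub>R C e) has_sum C f) E"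
        using has_sum_bounded_linear[OF bounded_linear orthonormal_expansion[OF E, of f]]
        by (simp add: C.scaleR)
      then have "((\<lambda>G. dist (?s G) (?s F)) \<longlongrightarrow> dist (C f) (?s F)) (finite_subsets_at_top E)"
        unfolding has_sum_def by (intro tendsto_intros)
      moreover have "\<forall>\<^sub>F G in finite_subsets_at_top E. dist (?s G) (?s F) \<le> \<delta>"
        unfolding eventually_finite_subsets_at_top using F(1,2) near by (intro exI[of _ F]) auto
      ultimately have d: "dist (C f) (?s F) \<le> \<delta>"
        by (rule tendsto_upperbound) simp
      \<comment> \<open>Coefficients in \<open>?K\<close> are bounded at every index, so they are
        cut off outside \<open>F\<close>.\<close>
      define c where "c e = (if e \<in> F then e \<bullet> f else 0)" for e
      have "\<bar>c e\<bar> \<le> 1" for e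
      proof (cases "e \<in> F")
        case True
        then have "norm e = 1" using onE F(2) by (auto simp: orthonormal_def)
        then show ?thesis using Cauchy_Schwarz_ineq2[of e f] f by (simp add: c_def)
      qed (simp add: c_def)
      moreover have "?s F = (\<Sum>e\<in>F. c e *\<^sub>R C e)" by (intro sum.cong) (auto simp: c_def)
      ultimately have "?s F \<in> ?K" by blast
      then obtain x where "x \<in> k" "dist x (?s F) < \<delta>" using k(2) by auto
      then have "dist x (C f) \<le> 2 * \<delta>"
        using d dist_triangle2[of x "C f" "?s F"] by simp
      with \<open>x \<in> k\<close> show ?thesis by auto
    qed
    then have "?W \<subseteq> (\<Union>x\<in>k. cball x (2 * \<delta>))" by auto
    \<comment> \<open>A finite union of closed balls is closed, so it contains the closure
      too.\<close>
    then have "closure ?W \<subseteq> (\<Union>x\<in>k. cball x (2 * \<delta>))"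
      by (rule closure_minimal) (use k(1) in auto)
    also have "\<dots> \<subseteq> (\<Union>x\<in>k. ball x \<epsilon>)"
      using \<delta> by (force simp: \<delta>_def)
    finally show "\<exists>k. finite k \<and> closure ?W \<subseteq> (\<Union>x\<in>k. ball x \<epsilon>)" using k(1) by blast
  qed
  moreover have "\<forall>n. C (v n) \<in> closure ?W"
    using assms by (auto intro: subsetD[OF closure_subset])
  ultimately obtain l r where "strict_mono (r :: nat \<Rightarrow> nat)" "((\<lambda>n. C (v n)) \<circ> r) \<longlonglongrightarrow> l"
    unfolding compact_def by metis
  then show ?thesis using that[of r l] by (simp add: o_def)
qed

text \<open>The Rayleigh quotient is maximised over the unit vectors of \<open>V\<close>. Along a
  maximising sequence \<open>C v - m v\<close> tends to 0 by \<open>norm_sq_le\<close>, and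
  compactness yields a limit, which is the eigenvector.\<close>

lemma eigenvector_in_invariant_subspace:
  assumes V: "subspace V" "closed V" and inv: "\<And>v. v \<in> V \<Longrightarrow> C v \<in> V" and ne: "\<exists>v\<in>V. v \<noteq> 0"
  obtains v m where "v \<in> V" and "norm v = 1" and "C v = m *\<^sub>R v"
    and "\<And>w. w \<in> V \<Longrightarrow> w \<bullet> C w \<le> m * (norm w)\<^sup>2"
proof -
  define Q where "Q = (\<lambda>v. v \<bullet> C v) ` {v \<in> V. norm v = 1}"
  define m where "m = Sup Q"
  obtain v0 where v0: "v0 \<in> V" "v0 \<noteq> 0" using ne by blast
  define u0 where "u0 = (1 / norm v0) *\<^sub>R v0"
  have u0: "u0 \<in> V" "norm u0 = 1"
    using v0 subspace_scale[OF V(1)] by (auto simp: u0_def)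
  then have Qne: "Q \<noteq> {}" by (auto simp: Q_def)
  obtain M where M: "0 < M" "\<And>x. norm (C x) \<le> norm x * M" using C.pos_bounded by blast
  have bdd: "bdd_above Q"
  proof (rule bdd_aboveI[of _ M])
    fix q assume "q \<in> Q"
    then obtain v where "norm v = 1" "q = v \<bullet> C v" by (auto simp: Q_def)
    then show "q \<le> M" using norm_cauchy_schwarz[of v "C v"] M(2)[of v] by simp
  qed
  have unit: "v \<bullet> C v \<le> m" if "v \<in> V" "norm v = 1" for v
    unfolding m_def using that by (intro cSup_upper bdd) (auto simp: Q_def)
  have form: "w \<bullet> C w \<le> m * (norm w)\<^sup>2" if "w \<in> V" for w
  proof (cases "w = 0")
    case False
    define u where "u = (1 / norm w) *\<^sub>R w"
    have "u \<bullet> C u \<le> m"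
      using False subspace_scale[OF V(1) that] by (intro unit) (auto simp: u_def)
    moreover have "u \<bullet> C u = (w \<bullet> C w) / (norm w)\<^sup>2"
      by (simp add: u_def C.scaleR power2_eq_square)
    ultimately show ?thesis using False by (simp add: divide_le_eq)
  qed (simp add: C.zero)
  have "0 \<le> m" using unit[OF u0] positive[of u0] by linarith
  show ?thesis
  proof (cases "m = 0")
    case True
    \<comment> \<open>For \<open>m = 0\<close> the form vanishes at \<open>u0\<close>.
      \<open>norm_sq_le\<close> wants a positive constant; 1 serves and gives
      \<open>C u0 = 0\<close>.\<close>
    have "C u0 \<bullet> C (C u0) \<le> 1 * (norm (C u0))\<^sup>2"
      by (rule order_trans[OF form[OF inv[OF u0(1)]]]) (simp add: True)
    then have "(norm (C u0))\<^sup>2 \<le> 1 * (u0 \<bullet> C u0)" by (intro norm_sq_le) simp_all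
    also have "\<dots> \<le> 0" using form[OF u0(1)] True by simp
    finally have "C u0 = m *\<^sub>R u0" using True by simp
    then show ?thesis using that[OF u0] form by blast
  next
    case False
    then have m: "0 < m" using \<open>0 \<le> m\<close> by simp
    have "\<exists>v. v \<in> V \<and> norm v = 1 \<and> m - 1 / real (Suc n) < v \<bullet> C v" for n
    proof -
      have "m - 1 / real (Suc n) < Sup Q" unfolding m_def by simp
      then show ?thesis unfolding less_cSup_iff[OF Qne bdd] by (auto simp: Q_def)
    qed
    then obtain v where v: "\<And>n. v n \<in> V" "\<And>n. norm (v n) = 1"
      and lim: "\<And>n. m - 1 / real (Suc n) < v n \<bullet> C (v n)" by metis
    obtain l r where r: "strict_mono (r :: nat \<Rightarrow> nat)" and l: "(\<lambda>n. C (v (r n))) \<longlonglongrightarrow> l"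
      by (rule compact_image[of v]) (use v(2) in auto)
    \<comment> \<open>After expansion, \<open>norm_sq_le\<close> leaves \<open>m\<close> times the
      amount by which \<open>v n\<close> misses the supremum.\<close>
    have sq: "(norm (C (v n) - m *\<^sub>R v n))\<^sup>2 \<le> m * (1 / real (Suc n))" for n
    proof -
      have "(norm (C (v n) - m *\<^sub>R v n))\<^sup>2 = (norm (C (v n)))\<^sup>2 - 2 * m * (v n \<bullet> C (v n)) + m\<^sup>2 * (norm (v n))\<^sup>2"
        by (simp add: power2_norm_eq_inner inner_diff inner_commute power2_eq_square[of m])
      also have "\<dots> \<le> m * (v n \<bullet> C (v n)) - 2 * m * (v n \<bullet> C (v n)) + m\<^sup>2"
        using norm_sq_le[OF m form[OF inv[OF v(1)]], of n] v(2) by simp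
      also have "\<dots> = m * (m - v n \<bullet> C (v n))"
        by (simp add: power2_eq_square algebra_simps)
      also have "\<dots> \<le> m * (1 / real (Suc n))"
        using lim[of n] m by (intro mult_left_mono) auto
      finally show ?thesis .
    qed
    have "(\<lambda>n. (norm (C (v n) - m *\<^sub>R v n))\<^sup>2) \<longlonglongrightarrow> 0"
    proof (rule tendsto_sandwich[OF _ _ tendsto_const])
      show "(\<lambda>n. m * (1 / real (Suc n))) \<longlonglongrightarrow> 0"
        using tendsto_mult_right_zero[OF LIMSEQ_inverse_real_of_nat, of m] by (simp add: field_simps)
    qed (use sq in auto)
    then have "(\<lambda>n. C (v n) - m *\<^sub>R v n) \<longlonglongrightarrow> 0"
      by (simp add: tendsto_norm_zero_iff)
    then have "(\<lambda>n. C (v (r n)) - m *\<^sub>R v (r n)) \<longlonglongrightarrow> 0"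
      using LIMSEQ_subseq_LIMSEQ[OF _ r] by (fastforce simp: o_def)
    \<comment> \<open>Compactness makes only the images under \<open>C\<close> converge; since
      \<open>m\<close> is positive, the vectors themselves follow.\<close>
    from tendsto_diff[OF l this] have "(\<lambda>n. m *\<^sub>R v (r n)) \<longlonglongrightarrow> l" by simp
    from tendsto_scaleR[OF tendsto_const[of "1 / m"] this] m
    have w: "(\<lambda>n. v (r n)) \<longlonglongrightarrow> (1 / m) *\<^sub>R l" by simp
    let ?w = "(1 / m) *\<^sub>R l"
    have "?w \<in> V" using closed_sequentially[OF V(2) _ w] v(1) by blast
    moreover have "norm ?w = 1"
      using tendsto_norm[OF w] by (simp only: v(2) LIMSEQ_const_iff)
    moreover have "C ?w = m *\<^sub>R ?w"
      using LIMSEQ_unique[OF C.tendsto[OF w] l] m by simp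
    ultimately show ?thesis using that form by blast
  qed
qed

text \<open>The orthogonal complement of a maximal orthonormal set of eigenvectors is closed and, by
  self-adjointness, invariant. Were it nonzero, it would contain another eigenvector.\<close>

lemma eigenbasis_exists: "\<exists>B. eigenbasis C B"
proof -
  define S where "S = {v. \<exists>\<sigma>. C v = \<sigma> *\<^sub>R v}"
  have scale: "c *\<^sub>R v \<in> S" if "v \<in> S" for c v
    using that by (auto simp: S_def C.scaleR intro: scaleR_left_commute)
  obtain B where B: "orthonormal B" "B \<subseteq> S"
    and max: "\<And>v. v \<in> S \<Longrightarrow> (\<And>b. b \<in> B \<Longrightarrow> b \<bullet> v = 0) \<Longrightarrow> v = 0"
    using maximal_orthonormal_set[of S] scale by blast
  define V where "V = {v. \<forall>b\<in>B. b \<bullet> v = 0}"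
  have "V = (\<Inter>b\<in>B. {v. b \<bullet> v = 0})" by (auto simp: V_def)
  then have "closed V" by (auto intro!: closed_Collect_eq continuous_intros)
  have sub: "subspace V" by (auto simp: V_def subspace_def inner_right_distrib)
  have inv: "C v \<in> V" if "v \<in> V" for v
  proof -
    have "b \<bullet> C v = 0" if b: "b \<in> B" for b
    proof -
      obtain \<sigma> where "C b = \<sigma> *\<^sub>R b" using b B(2) by (auto simp: S_def)
      then show ?thesis using \<open>v \<in> V\<close> b by (simp add: self_adjoint[symmetric] V_def)
    qed
    then show ?thesis by (simp add: V_def)
  qed
  have "v = 0" if "v \<in> V" for v
  proof (rule ccontr)
    assume "v \<noteq> 0"
    show False
    proof (rule eigenvector_in_invariant_subspace[OF sub \<open>closed V\<close>])
      fix w m assume "w \<in> V" "norm w = 1" "C w = m *\<^sub>R w"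
      then show False using max[of w] by (auto simp: S_def V_def)
    qed (use inv that \<open>v \<noteq> 0\<close> in auto)
  qed
  then have "orthonormal_basis B"
    by (intro orthonormal_basis_if_total[OF B(1)]) (auto simp: V_def)
  then show ?thesis using B(2) unfolding eigenbasis_def S_def by blast
qed

text \<open>The maximum of the Rayleigh quotient over the whole space is an eigenvalue and bounds
  all others.\<close>

lemma le_largest_eigenvalue:
  assumes "is_eigenvalue C \<sigma>"
  shows "\<sigma> \<le> largest_eigenvalue C"
proof -
  have "\<exists>v\<in>UNIV. v \<noteq> (0::'a)" using assms by (auto simp: is_eigenvalue_def)
  then obtain v m where v: "norm v = 1" "C v = m *\<^sub>R v" and max: "\<And>w. w \<bullet> C w \<le> m * (norm w)\<^sup>2"
    using eigenvector_in_invariant_subspace[of UNIV] by auto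
  show ?thesis
  proof (rule is_eigenvalue_le_largest[OF _ _ assms])
    show "is_eigenvalue C m" using v unfolding is_eigenvalue_def by (intro exI[of _ v]) auto
    fix \<tau> assume "is_eigenvalue C \<tau>"
    then obtain w where "w \<noteq> 0" "C w = \<tau> *\<^sub>R w" by (auto simp: is_eigenvalue_def)
    then show "\<tau> \<le> m" using max[of w] by (simp add: power2_norm_eq_inner)
  qed
qed

section \<open>Powers of \<open>C\<close> in a fixed eigenbasis\<close>

text \<open>The same \<open>SOME\<close> term as in \<open>op_powr\<close>, so that powers of
  \<open>C\<close> unfold to series over this set.\<close>

definition eigvecs :: "'a set" where
  "eigvecs = (SOME B. eigenbasis C B)"

definition eigval :: "'a \<Rightarrow> real" where
  "eigval b = b \<bullet> C b"

text \<open>The factor by which \<open>op_powr C r\<close> scales the eigenvector \<open>b\<close>.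
  The case \<open>r = 0\<close> is separate because \<open>0 powr 0 = 0\<close>.\<close>

definition power_eigval :: "real \<Rightarrow> 'a \<Rightarrow> real" where
  "power_eigval r b = (if r = 0 then 1 else eigval b powr r)"

lemma eigenbasis_eigvecs: "eigenbasis C eigvecs"
  unfolding eigvecs_def by (rule someI_ex[OF eigenbasis_exists])

lemma basis_eigvecs: "orthonormal_basis eigvecs"
  using eigenbasis_eigvecs by (simp add: eigenbasis_def)

lemma orthonormal_eigvecs: "orthonormal eigvecs"
  using basis_eigvecs by (simp add: orthonormal_basis_iff)

lemma norm_eigvecs: "b \<in> eigvecs \<Longrightarrow> norm b = 1"
  using orthonormal_eigvecs by (simp add: orthonormal_def)

lemma C_eigvecs: "b \<in> eigvecs \<Longrightarrow> C b = eigval b *\<^sub>R b"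
  using eigenbasis_eigvecs norm_eigvecs[of b]
  by (auto simp: eigenbasis_def eigval_def power2_norm_eq_inner[symmetric] norm_eq_1)

lemma eigval_nonneg: "0 \<le> eigval b"
  unfolding eigval_def by (rule positive)

lemma eigval_le: "b \<in> eigvecs \<Longrightarrow> eigval b \<le> K"
  using trace_le[of "{b}"] orthonormal_subset[OF orthonormal_eigvecs, of "{b}"] by (simp add: eigval_def)

lemma eigval_le_largest: "b \<in> eigvecs \<Longrightarrow> eigval b \<le> largest_eigenvalue C"
  using norm_eigvecs[of b] C_eigvecs[of b]
  by (intro le_largest_eigenvalue) (auto simp: is_eigenvalue_def intro!: exI[of _ b])

lemma eigval_summable: "eigval summable_on eigvecs"
  using trace_le orthonormal_subset[OF orthonormal_eigvecs]
  by (intro summable_on_nonneg_real[of _ _ K]) (auto simp: eigval_nonneg, simp add: eigval_def)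

lemma power_eigval_nonneg: "0 \<le> power_eigval r b"
  by (simp add: power_eigval_def)

lemma power_eigval_le: "0 \<le> r \<Longrightarrow> b \<in> eigvecs \<Longrightarrow> power_eigval r b \<le> 1 + K powr r"
  using powr_mono2[of r "eigval b" K] by (simp add: power_eigval_def eigval_nonneg eigval_le)

text \<open>The factors are bounded, so the coefficients stay square summable and Riesz-Fischer
  applies; the \<open>infsum\<close> in \<open>op_powr\<close> is thus a genuine limit.\<close>

lemma op_powr_has_sum:
  assumes "0 \<le> r"
  shows "((\<lambda>b. (power_eigval r b * (b \<bullet> f)) *\<^sub>R b) has_sum op_powr C r f) eigvecs"
proof (cases "r = 0")
  case True
  then show ?thesis
    using orthonormal_expansion[OF basis_eigvecs, of f] by (simp add: op_powr_def power_eigval_def)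
next
  case False
  have "(\<lambda>b. (power_eigval r b * (b \<bullet> f))\<^sup>2) summable_on eigvecs"
  proof (rule summable_on_comparison_test)
    show "(\<lambda>b. (1 + K powr r)\<^sup>2 * (b \<bullet> f)\<^sup>2) summable_on eigvecs"
      by (intro summable_on_cmult_right Bessel_summable orthonormal_eigvecs)
    show "(power_eigval r b * (b \<bullet> f))\<^sup>2 \<le> (1 + K powr r)\<^sup>2 * (b \<bullet> f)\<^sup>2" if "b \<in> eigvecs" for b
      unfolding power_mult_distrib
      by (intro mult_right_mono power_mono power_eigval_le power_eigval_nonneg assms that) simp
  qed simp
  from Riesz_Fischer[OF orthonormal_eigvecs this] show ?thesis
    unfolding op_powr_def eigvecs_def[symmetric] eigval_def[symmetric] power_eigval_def
    using False by simp
qed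

lemma inner_op_powr:
  assumes "0 \<le> r" and "b \<in> eigvecs"
  shows "b \<bullet> op_powr C r f = power_eigval r b * (b \<bullet> f)"
  using inner_has_sum_orthonormal[OF orthonormal_eigvecs op_powr_has_sum] assms by blast

lemma op_powr_eigvecs:
  assumes "0 \<le> r" and "b \<in> eigvecs"
  shows "op_powr C r b = power_eigval r b *\<^sub>R b"
proof -
  have "((\<lambda>a. (power_eigval r a * (a \<bullet> b)) *\<^sub>R a) has_sum power_eigval r b *\<^sub>R b) eigvecs"
    using assms(2) orthonormal_inner[OF orthonormal_eigvecs]
    by (intro has_sum_finite_neutralI[where B = "{b}"]) auto
  with op_powr_has_sum[OF assms(1)] show ?thesis by (rule has_sum_unique)
qed

text \<open>The operator is symmetric and defined everywhere.\<close>

lemma bounded_linear_op_powr: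
  assumes "0 \<le> r"
  shows "bounded_linear (op_powr C r)"
proof (rule Hellinger_Toeplitz)
  fix f g
  have "((\<lambda>b. power_eigval r b * (b \<bullet> f) * (b \<bullet> g)) has_sum (op_powr C r f \<bullet> g)) eigvecs"
    using has_sum_inner_left[OF op_powr_has_sum[OF assms, of f], of g] by simp
  moreover have "((\<lambda>b. power_eigval r b * (b \<bullet> f) * (b \<bullet> g)) has_sum (f \<bullet> op_powr C r g)) eigvecs"
    using has_sum_inner_right[OF op_powr_has_sum[OF assms, of g], of f]
    by (simp add: inner_commute[of f] mult.assoc mult.commute[of "_ \<bullet> f"])
  ultimately show "op_powr C r f \<bullet> g = f \<bullet> op_powr C r g" by (rule has_sum_unique)
qed

section \<open>Comparison of weighted Hilbert-Schmidt norms\<close>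

text \<open>Since \<open>2 * \<gamma> - 1\<close> is nonnegative, one factor \<open>eigval b\<close>
  splits off from the bound on \<open>(norm (D b))\<^sup>2\<close> and the rest is bounded; the
  trace condition makes the series converge, also for \<open>s = 0\<close>.\<close>

lemma hs_norm_comp_op_powr:
  assumes D: "bounded_linear D" and \<gamma>: "1 / 2 \<le> \<gamma>" and s: "0 \<le> s"
    and DK: "\<And>b. b \<in> eigvecs \<Longrightarrow> norm (D b) \<le> L * eigval b powr \<gamma>"
  shows "((\<lambda>b. (power_eigval (s / 2) b)\<^sup>2 * (norm (D b))\<^sup>2) has_sum (hs_norm (D \<circ> op_powr C (s / 2)))\<^sup>2) eigvecs"
proof -
  interpret D: bounded_linear D by fact
  let ?T = "D \<circ> op_powr C (s / 2)"
  have T: "bounded_linear ?T"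
    unfolding o_def using s by (intro bounded_linear_compose[OF D] bounded_linear_op_powr) simp
  have eq: "(norm (?T b))\<^sup>2 = (power_eigval (s / 2) b)\<^sup>2 * (norm (D b))\<^sup>2" if "b \<in> eigvecs" for b
    using s that by (simp add: op_powr_eigvecs D.scaleR power_mult_distrib)
  have "(\<lambda>b. (power_eigval (s / 2) b)\<^sup>2 * (norm (D b))\<^sup>2) summable_on eigvecs"
  proof (rule summable_on_comparison_test)
    show "(\<lambda>b. ((1 + K powr (s / 2))\<^sup>2 * L\<^sup>2 * K powr (2 * \<gamma> - 1)) * eigval b) summable_on eigvecs"
      by (intro summable_on_cmult_right eigval_summable)
    fix b assume b: "b \<in> eigvecs"
    have "(norm (D b))\<^sup>2 \<le> (L * eigval b powr \<gamma>)\<^sup>2"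
      using DK[OF b] by (rule power_mono) simp
    also have "\<dots> = L\<^sup>2 * eigval b powr (2 * \<gamma>)"
      by (simp add: power_mult_distrib power2_eq_square[of "_ powr _"] flip: powr_add)
    also have "eigval b powr (2 * \<gamma>) = eigval b powr (2 * \<gamma> - 1) * eigval b"
      using eigval_nonneg[of b] \<gamma> by (cases "eigval b = 0") (simp_all add: powr_diff)
    also have "\<dots> \<le> K powr (2 * \<gamma> - 1) * eigval b"
      using \<gamma> by (intro mult_right_mono powr_mono2 eigval_nonneg eigval_le[OF b]) auto
    finally have "(norm (D b))\<^sup>2 \<le> L\<^sup>2 * (K powr (2 * \<gamma> - 1) * eigval b)"
      by (simp add: mult_left_mono)
    moreover have "(power_eigval (s / 2) b)\<^sup>2 \<le> (1 + K powr (s / 2))\<^sup>2"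
      using s by (intro power_mono power_eigval_le power_eigval_nonneg b) simp
    ultimately show "(power_eigval (s / 2) b)\<^sup>2 * (norm (D b))\<^sup>2 \<le>
        ((1 + K powr (s / 2))\<^sup>2 * L\<^sup>2 * K powr (2 * \<gamma> - 1)) * eigval b"
      using mult_mono[of "(power_eigval (s / 2) b)\<^sup>2" "(1 + K powr (s / 2))\<^sup>2" "(norm (D b))\<^sup>2"]
      by (simp add: mult.assoc)
  qed simp
  then have sT: "(\<lambda>b. (norm (?T b))\<^sup>2) summable_on eigvecs"
    using eq by (simp cong: summable_on_cong)
  then have "((\<lambda>b. (norm (?T b))\<^sup>2) has_sum (hs_norm ?T)\<^sup>2) eigvecs"
    unfolding hs_norm_sq_eq[OF T basis_eigvecs sT] by (rule has_sum_infsum)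
  then show ?thesis by (rule has_sum_cong[THEN iffD1, rotated]) (rule eq)
qed

lemma hs_norm_comp_op_powr_le:
  assumes D: "bounded_linear D" and \<gamma>: "1 / 2 \<le> \<gamma>" and s: "0 \<le> s'" "s' \<le> s"
    and DK: "\<And>b. b \<in> eigvecs \<Longrightarrow> norm (D b) \<le> L * eigval b powr \<gamma>"
  shows "(hs_norm (D \<circ> op_powr C (s / 2)))\<^sup>2
    \<le> largest_eigenvalue C powr (s - s') * (hs_norm (D \<circ> op_powr C (s' / 2)))\<^sup>2"
proof (rule has_sum_mono)
  show "((\<lambda>b. (power_eigval (s / 2) b)\<^sup>2 * (norm (D b))\<^sup>2)
      has_sum (hs_norm (D \<circ> op_powr C (s / 2)))\<^sup>2) eigvecs"
    using s by (intro hs_norm_comp_op_powr[OF D \<gamma> _ DK]) simp_all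
  show "((\<lambda>b. largest_eigenvalue C powr (s - s') * ((power_eigval (s' / 2) b)\<^sup>2 * (norm (D b))\<^sup>2))
      has_sum largest_eigenvalue C powr (s - s') * (hs_norm (D \<circ> op_powr C (s' / 2)))\<^sup>2) eigvecs"
    by (intro has_sum_cmult_right hs_norm_comp_op_powr[OF D \<gamma> s(1) DK])
  fix b assume b: "b \<in> eigvecs"
  show "(power_eigval (s / 2) b)\<^sup>2 * (norm (D b))\<^sup>2
      \<le> largest_eigenvalue C powr (s - s') * ((power_eigval (s' / 2) b)\<^sup>2 * (norm (D b))\<^sup>2)"
  proof (cases "eigval b = 0")
    case True
    \<comment> \<open>Here \<open>0 powr \<gamma> = 0\<close> forces \<open>D b = 0\<close>, so the
      kernel of \<open>C\<close> contributes nothing even when \<open>s = 0\<close>.\<close>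
    then show ?thesis using DK[OF b] by simp
  next
    case False
    then have pos: "0 < eigval b" using eigval_nonneg[of b] by simp
    have sq: "(power_eigval (t / 2) b)\<^sup>2 = eigval b powr t" for t
      using pos by (simp add: power_eigval_def power2_eq_square flip: powr_add)
    have "eigval b powr s = eigval b powr (s - s') * eigval b powr s'"
      by (simp add: powr_add[symmetric])
    also have "\<dots> \<le> largest_eigenvalue C powr (s - s') * eigval b powr s'"
      using s by (intro mult_right_mono powr_mono2 eigval_nonneg eigval_le_largest b) auto
    finally show ?thesis
      unfolding sq mult.assoc[symmetric] by (rule mult_right_mono) simp
  qed
qed

text \<open>If \<open>A g\<close> is \<open>op_powr C \<gamma> h\<close>, then \<open>T b\<close>
  scaled by the inverse of \<open>eigval b powr \<gamma>\<close> has inner product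
  \<open>b \<bullet> h\<close> with \<open>g\<close>, at most \<open>norm h\<close> in absolute
  value. Although \<open>h\<close> depends on \<open>g\<close>, uniform boundedness yields one
  constant.\<close>

lemma norm_adjoint_eigvecs_le:
  fixes A :: "'b::{real_inner,banach} \<Rightarrow> 'a" and T :: "'a \<Rightarrow> 'b"
  assumes adj: "\<And>g f. A g \<bullet> f = g \<bullet> T f" and range: "\<And>g. A g \<in> range (op_powr C \<gamma>)"
    and \<gamma>: "0 < \<gamma>"
  obtains L where "\<And>b. b \<in> eigvecs \<Longrightarrow> norm (T b) \<le> L * eigval b powr \<gamma>"
proof -
  have Ag: "\<exists>h. \<forall>b\<in>eigvecs. g \<bullet> T b = eigval b powr \<gamma> * (b \<bullet> h)" for g
  proof -
    obtain h where "A g = op_powr C \<gamma> h" using range[of g] by blast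
    then have "g \<bullet> T b = eigval b powr \<gamma> * (b \<bullet> h)" if "b \<in> eigvecs" for b
      using inner_op_powr[of \<gamma> b h] that \<gamma>
      by (simp add: adj[symmetric] inner_commute[of _ b] power_eigval_def)
    then show ?thesis by blast
  qed
  \<comment> \<open>For eigenvalue 0 the scaled vector is 0 by division by zero, so
    \<open>T b\<close> is treated separately there.\<close>
  obtain L where L: "0 \<le> L" "\<And>b. b \<in> eigvecs \<Longrightarrow> norm ((1 / eigval b powr \<gamma>) *\<^sub>R T b) \<le> L"
  proof (rule uniform_boundedness_inner[where I = eigvecs and a = "\<lambda>b. (1 / eigval b powr \<gamma>) *\<^sub>R T b"])
    fix g
    obtain h where h: "\<And>b. b \<in> eigvecs \<Longrightarrow> g \<bullet> T b = eigval b powr \<gamma> * (b \<bullet> h)" using Ag by blast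
    have "\<bar>((1 / eigval b powr \<gamma>) *\<^sub>R T b) \<bullet> g\<bar> \<le> norm h" if "b \<in> eigvecs" for b
    proof (cases "eigval b = 0")
      case False
      then show ?thesis
        using h[OF that] Cauchy_Schwarz_ineq2[of b h] norm_eigvecs[OF that]
        by (simp add: inner_commute[of _ g])
    qed simp
    then show "\<exists>K. \<forall>b\<in>eigvecs. \<bar>((1 / eigval b powr \<gamma>) *\<^sub>R T b) \<bullet> g\<bar> \<le> K" by blast
  qed blast
  have "norm (T b) \<le> L * eigval b powr \<gamma>" if b: "b \<in> eigvecs" for b
  proof (cases "eigval b = 0")
    case True
    \<comment> \<open>As \<open>0 powr \<gamma> = 0\<close>, \<open>T b\<close> is orthogonal to
      every vector, in particular to itself.\<close>
    have "T b \<bullet> T b = 0" using Ag[of "T b"] b True by auto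
    then show ?thesis by (simp add: True)
  next
    case False
    then have "0 < eigval b powr \<gamma>" by simp
    then show ?thesis using L(2)[OF b] by (simp add: field_simps)
  qed
  then show ?thesis by (rule that)
qed

end

subsection \<open>Reproducing kernel Hilbert spaces\<close>

lemma rkhs_eqI: "is_rkhs evh k \<Longrightarrow> (\<And>x. evh f x = evh g x) \<Longrightarrow> f = g"
  unfolding is_rkhs_def inj_def by blast

lemma rkhs_linear: "is_rkhs evh k \<Longrightarrow> linear (\<lambda>f. evh f x)"
  unfolding is_rkhs_def by blast

lemma norm_feature_sq: "is_rkhs evh k \<Longrightarrow> (norm (feature evh k x))\<^sup>2 = k x x"
  by (metis ev_feature power2_norm_eq_inner reproducing)

text \<open>The feature map is continuous, because its squared distances are expressed by the
  continuous \<open>k\<close>, and \<open>evh f\<close> is its inner product with \<open>f\<close>.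
  This supplies Borel measurability.\<close>

lemma continuous_rkhs:
  fixes evh :: "'h::real_inner \<Rightarrow> 'x::topological_space \<Rightarrow> real"
  assumes rk: "is_rkhs evh k" and cont: "continuous_on UNIV (\<lambda>(x, y). k x y)"
  shows "continuous_on UNIV (evh f)"
  unfolding continuous_on_def
proof (intro ballI)
  fix x
  let ?\<phi> = "feature evh k"
  have ck: "continuous_on UNIV (\<lambda>y. k (a y) (b y))"
    if "continuous_on UNIV a" "continuous_on UNIV b" for a b :: "'x \<Rightarrow> 'x"
    using continuous_on_compose2[OF cont continuous_on_Pair[OF that]] by simp
  have k: "?\<phi> y \<bullet> ?\<phi> z = k y z" for y z
    using ev_feature[OF rk, of z y] reproducing[OF rk, of "?\<phi> z" y] by (simp add: inner_commute)
  have sym: "k y z = k z y" for y z by (simp add: k[symmetric] inner_commute)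
  have "continuous_on UNIV (\<lambda>y. sqrt (k y y - 2 * k y x + k x x))"
    by (intro continuous_intros ck)
  from this[unfolded continuous_on_def, rule_format, of x]
  have "((\<lambda>y. sqrt (k y y - 2 * k y x + k x x)) \<longlongrightarrow> 0) (at x)" by simp
  moreover have "sqrt (k y y - 2 * k y x + k x x) = norm (?\<phi> y - ?\<phi> x)" for y
    by (simp add: norm_eq_sqrt_inner inner_diff k sym[of x y])
  ultimately have "((\<lambda>y. norm (?\<phi> y - ?\<phi> x)) \<longlongrightarrow> 0) (at x)" by simp
  then have "((\<lambda>y. ?\<phi> y - ?\<phi> x) \<longlongrightarrow> 0) (at x)" by (rule tendsto_norm_zero_cancel)
  then have "(?\<phi> \<longlongrightarrow> ?\<phi> x) (at x)" by (rule LIM_zero_cancel)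
  from tendsto_inner[OF tendsto_const[of f] this] show "(evh f \<longlongrightarrow> evh f x) (at x)"
    unfolding reproducing[OF rk, symmetric] .
qed

section \<open>The mixture and its covariance operator\<close>

lemma sets_mixture [simp]: "sets (mixture \<alpha> \<mu> \<nu>) = sets \<mu>"
  by (simp add: mixture_def sets.space_closed)

lemma prob_space_mixture:
  assumes "prob_space \<mu>" and "prob_space \<nu>" and sets: "sets \<nu> = sets \<mu>" and "0 \<le> \<alpha>" "\<alpha> \<le> 1"
  shows "prob_space (mixture \<alpha> \<mu> \<nu>)"
proof
  have sp: "space (mixture \<alpha> \<mu> \<nu>) = space \<mu>" "space \<nu> = space \<mu>"
    by (rule sets_eq_imp_space_eq, simp add: sets)+
  then show "emeasure (mixture \<alpha> \<mu> \<nu>) (space (mixture \<alpha> \<mu> \<nu>)) = 1"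
    using prob_space.emeasure_space_1[OF assms(1)] prob_space.emeasure_space_1[OF assms(2)] assms(4,5)
    by (simp add: emeasure_mixture[OF sets] ennreal_plus[symmetric] del: ennreal_plus)
qed

text \<open>All properties are read off from the quadratic form. By Bessel, the integrand of a
  partial trace is at most the squared norm of the feature at \<open>x\<close>, which is
  \<open>k x x\<close>.\<close>

lemma positive_trace_class_cov_op:
  fixes evh :: "'h::{real_inner,banach,second_countable_topology} \<Rightarrow> 'x::topological_space \<Rightarrow> real"
  assumes rk: "is_rkhs evh k" and cont: "continuous_on UNIV (\<lambda>(x, y). k x y)"
    and bdd: "\<And>x. k x x \<le> kmax" and "prob_space R" and setsR: "sets R = sets borel"
  shows "positive_trace_class (cov_op evh k R) kmax"
proof (rule positive_trace_class.intro)
  interpret prob_space R by fact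
  let ?C = "cov_op evh k R"
  note form = inner_cov_op[OF rk cont bdd \<open>prob_space R\<close> setsR]
  show adj: "?C f \<bullet> g = f \<bullet> ?C g" for f g
    unfolding inner_commute[of "?C f"] form by (simp add: mult.commute)
  from Hellinger_Toeplitz[OF this] show "bounded_linear ?C" .
  show "0 \<le> f \<bullet> ?C f" for f unfolding form by simp
  fix F :: "'h set" assume F: "finite F" "orthonormal F"
  have meas: "evh f \<in> borel_measurable R" for f
    using borel_measurable_continuous_onI[OF continuous_rkhs[OF rk cont]] measurable_cong_sets[OF setsR refl]
    by blast
  have int: "integrable R (\<lambda>x. evh f x * evh f x)" for f
  proof (rule integrable_const_bound[where B = "(norm f)\<^sup>2 * kmax"])
    have "evh f x * evh f x \<le> (norm f)\<^sup>2 * kmax" for x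
    proof -
      have "evh f x * evh f x = (f \<bullet> feature evh k x)\<^sup>2"
        by (simp add: reproducing[OF rk] power2_eq_square)
      also have "\<dots> \<le> (norm f)\<^sup>2 * (norm (feature evh k x))\<^sup>2"
        using Cauchy_Schwarz_ineq[of f "feature evh k x"] by (simp add: power2_norm_eq_inner)
      also have "\<dots> \<le> (norm f)\<^sup>2 * kmax"
        unfolding norm_feature_sq[OF rk] by (intro mult_left_mono bdd) simp
      finally show ?thesis .
    qed
    then show "AE x in R. norm (evh f x * evh f x) \<le> (norm f)\<^sup>2 * kmax" by simp
    show "(\<lambda>x. evh f x * evh f x) \<in> borel_measurable R" using meas by measurable
  qed
  have "(\<Sum>b\<in>F. b \<bullet> ?C b) = (LINT x|R. (\<Sum>b\<in>F. evh b x * evh b x))"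
    unfolding form by (rule Bochner_Integration.integral_sum[symmetric]) (rule int)
  also have "\<dots> \<le> (LINT x|R. kmax)"
  proof (rule integral_mono)
    fix x
    have "(\<Sum>b\<in>F. evh b x * evh b x) = (\<Sum>b\<in>F. (b \<bullet> feature evh k x)\<^sup>2)"
      by (simp add: reproducing[OF rk] power2_eq_square)
    also have "\<dots> \<le> (norm (feature evh k x))\<^sup>2"
      by (rule Bessel_finite[OF F(2,1)])
    also have "\<dots> \<le> kmax" unfolding norm_feature_sq[OF rk] by (rule bdd)
    finally show "(\<Sum>b\<in>F. evh b x * evh b x) \<le> kmax" .
  qed (use int in auto)
  also have "\<dots> = kmax" by (simp add: prob_space)
  finally show "(\<Sum>b\<in>F. b \<bullet> ?C b) \<le> kmax" .
qed

subsection \<open>Conditional mean operators\<close>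

text \<open>Convergence in the RKHS is pointwise, so the \<open>L\<^sup>1\<close> seminorm is lower semicontinuous by Fatou.\<close>
lemma rkhs_integral_bounded:
  fixes evl :: "'g::{real_inner,banach} \<Rightarrow> 'y \<Rightarrow> real"
  assumes rk: "is_rkhs evl l" and int: "\<And>g. integrable \<mu> (evl g)"
  obtains K where "\<And>g. \<bar>LINT y|\<mu>. evl g y\<bar> \<le> K * norm g"
proof -
  have add: "evl (g + h) y = evl g y + evl h y" and scale: "evl (c *\<^sub>R g) y = c * evl g y" for g h c y
    using linear_add[OF rkhs_linear[OF rk]] linear_scale[OF rkhs_linear[OF rk]] by auto
  \<comment> \<open>A family of one seminorm, indexed by \<open>unit\<close>.\<close>
  obtain K where K: "\<And>g. (LINT y|\<mu>. \<bar>evl g y\<bar>) \<le> K * norm g"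
  proof (rule uniform_boundedness_seminorms[where I = UNIV and q = "\<lambda>_ g. LINT y|\<mu>. \<bar>evl g y\<bar>"])
    fix i :: unit and g h :: 'g and c :: real
    have "(LINT y|\<mu>. \<bar>evl (g + h) y\<bar>) \<le> (LINT y|\<mu>. \<bar>evl g y\<bar> + \<bar>evl h y\<bar>)"
      unfolding add by (intro integral_mono integrable_abs Bochner_Integration.integrable_add int) auto
    then show "(LINT y|\<mu>. \<bar>evl (g + h) y\<bar>) \<le> (LINT y|\<mu>. \<bar>evl g y\<bar>) + (LINT y|\<mu>. \<bar>evl h y\<bar>)"
      by (simp add: int)
    show "(LINT y|\<mu>. \<bar>evl (c *\<^sub>R g) y\<bar>) = \<bar>c\<bar> * (LINT y|\<mu>. \<bar>evl g y\<bar>)"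
      by (simp add: scale abs_mult)
    show "closed {g. (LINT y|\<mu>. \<bar>evl g y\<bar>) \<le> c}"
      unfolding closed_sequential_limits
    proof (intro allI impI, elim conjE)
      fix g :: "nat \<Rightarrow> 'g" and g0
      assume "\<forall>n. g n \<in> {g. (LINT y|\<mu>. \<bar>evl g y\<bar>) \<le> c}" and lim: "g \<longlonglongrightarrow> g0"
      then have le: "(LINT y|\<mu>. \<bar>evl (g n) y\<bar>) \<le> c" for n by auto
      have nn: "(\<integral>\<^sup>+y. ennreal \<bar>evl g y\<bar> \<partial>\<mu>) = ennreal (LINT y|\<mu>. \<bar>evl g y\<bar>)" for g
        by (intro nn_integral_eq_integral) (auto simp: int)
      \<comment> \<open>\<open>ennreal\<close> sends negative numbers to 0, so \<open>c\<close> must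
        be nonnegative for the final bound to pass back to the reals.\<close>
      have "0 \<le> (LINT y|\<mu>. \<bar>evl (g 0) y\<bar>)" by simp
      with le[of 0] have c: "0 \<le> c" by linarith
      have pt: "liminf (\<lambda>n. ennreal \<bar>evl (g n) y\<bar>) = ennreal \<bar>evl g0 y\<bar>" for y
      proof -
        have "(\<lambda>n. evl (g n) y) \<longlonglongrightarrow> evl g0 y"
          using tendsto_inner[OF lim tendsto_const[of "feature evl l y"]]
          by (simp add: reproducing[OF rk, symmetric])
        then have "(\<lambda>n. ennreal \<bar>evl (g n) y\<bar>) \<longlonglongrightarrow> ennreal \<bar>evl g0 y\<bar>"
          by (intro tendsto_ennrealI tendsto_rabs)
        then show ?thesis by (rule lim_imp_Liminf[OF sequentially_bot])
      qed
      have "ennreal (LINT y|\<mu>. \<bar>evl g0 y\<bar>) = (\<integral>\<^sup>+y. liminf (\<lambda>n. ennreal \<bar>evl (g n) y\<bar>) \<partial>\<mu>)"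
        unfolding pt nn ..
      also have "\<dots> \<le> liminf (\<lambda>n. \<integral>\<^sup>+y. ennreal \<bar>evl (g n) y\<bar> \<partial>\<mu>)"
        using borel_measurable_integrable[OF int] by (intro nn_integral_liminf) measurable
      also have "\<dots> \<le> ennreal c"
        unfolding nn using le by (intro Liminf_le always_eventually allI ennreal_leI) auto
      finally show "g0 \<in> {g. (LINT y|\<mu>. \<bar>evl g y\<bar>) \<le> c}"
        using c by simp
    qed
  qed auto
  have "\<bar>LINT y|\<mu>. evl g y\<bar> \<le> K * norm g" for g
    by (rule order_trans[OF integral_abs_bound K])
  then show ?thesis by (rule that)
qed

text \<open>\<open>adjoint\<close> is a choice among adjoints, so one must be shown to exist. The
  vectors \<open>f\<close> for which \<open>?A g \<bullet> f\<close> is a bounded functional of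
  \<open>g\<close> form a closed subspace \<open>S\<close> containing all features. A vector
  orthogonal to the features is the zero function, so \<open>S\<close> is everything, and Riesz
  representation gives the adjoint.\<close>

lemma
  fixes evk :: "'h::{real_inner,banach} \<Rightarrow> 'x \<Rightarrow> real" and evl :: "'g::{real_inner,banach} \<Rightarrow> 'y \<Rightarrow> real"
  assumes rk: "is_rkhs evk k" and rl: "is_rkhs evl l" and range: "cond_means_in_range evk evl \<kappa> C \<gamma>"
  shows cond_mean_op_adj_in_range: "cond_mean_op_adj evk evl \<kappa> g \<in> range (op_powr C \<gamma>)"
    and inner_cond_mean_op: "cond_mean_op_adj evk evl \<kappa> g \<bullet> f = g \<bullet> cond_mean_op evk evl \<kappa> f"
proof -
  let ?A = "cond_mean_op_adj evk evl \<kappa>"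
  have int: "integrable (\<kappa> x) (evl g)"
    and mem: "(\<lambda>x. LINT y|\<kappa> x. evl g y) \<in> evk ` range (op_powr C \<gamma>)" for g x
    using range by (auto simp: cond_means_in_range_def)
  have inj: "inj evk" using rk by (simp add: is_rkhs_def)
  show "?A g \<in> range (op_powr C \<gamma>)" for g
    using mem[of g] inj by (auto simp: cond_mean_op_adj_def)
  have ev: "evk (?A g) x = (LINT y|\<kappa> x. evl g y)" for g x
  proof -
    have "evk (?A g) = (\<lambda>x. LINT y|\<kappa> x. evl g y)"
      unfolding cond_mean_op_adj_def using mem[of g] by (intro f_inv_into_f) auto
    then show ?thesis by simp
  qed
  have add: "?A (g + h) = ?A g + ?A h" and scale: "?A (c *\<^sub>R g) = c *\<^sub>R ?A g" for g h c
    by (rule rkhs_eqI[OF rk], simp add: ev linear_add[OF rkhs_linear[OF rk]] linear_scale[OF rkhs_linear[OF rk]]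
      linear_add[OF rkhs_linear[OF rl]] linear_scale[OF rkhs_linear[OF rl]] int)+
  define S where "S = {f. \<exists>K. \<forall>g. \<bar>?A g \<bullet> f\<bar> \<le> K * norm g}"
  have "S = UNIV"
  proof (rule closed_subspace_eq_UNIV)
    show "subspace S"
      unfolding subspace_def
    proof (intro conjI ballI allI)
      show "0 \<in> S" by (auto simp: S_def intro: exI[of _ 0])
      fix f f' assume "f \<in> S" "f' \<in> S"
      then obtain K K' where K: "\<And>g. \<bar>?A g \<bullet> f\<bar> \<le> K * norm g" "\<And>g. \<bar>?A g \<bullet> f'\<bar> \<le> K' * norm g"
        by (auto simp: S_def)
      have "\<bar>?A g \<bullet> (f + f')\<bar> \<le> (K + K') * norm g" for g
        using K[of g] by (simp add: inner_add_right distrib_right)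
      then show "f + f' \<in> S" unfolding S_def by blast
    next
      fix f c assume "f \<in> S"
      then obtain K where K: "\<And>g. \<bar>?A g \<bullet> f\<bar> \<le> K * norm g" by (auto simp: S_def)
      have "\<bar>?A g \<bullet> (c *\<^sub>R f)\<bar> \<le> (\<bar>c\<bar> * K) * norm g" for g
        using mult_left_mono[OF K[of g], of "\<bar>c\<bar>"] by (simp add: abs_mult mult.assoc)
      then show "c *\<^sub>R f \<in> S" unfolding S_def by blast
    qed
    show "closed S"
      unfolding closed_sequential_limits
    proof (intro allI impI, elim conjE)
      \<comment> \<open>The constants of the \<open>f n\<close> could grow, as \<open>?A\<close> is
        not known to be bounded. But the \<open>f n\<close> are bounded, hence so are the
        functionals at each \<open>g\<close>, and uniform boundedness gives a common
        constant.\<close>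
      fix f :: "nat \<Rightarrow> 'h" and f0 assume fS: "\<forall>n. f n \<in> S" and lim: "f \<longlonglongrightarrow> f0"
      obtain M where M: "\<And>n. norm (f n) \<le> M"
        using convergent_imp_Bseq[of f] lim by (auto simp: convergent_def Bseq_def)
      obtain K where K: "\<And>n g. \<bar>?A g \<bullet> f n\<bar> \<le> K * norm g"
      proof (rule uniform_boundedness_seminorms[where I = UNIV and q = "\<lambda>n g. \<bar>?A g \<bullet> f n\<bar>"])
        fix n :: nat and c :: real
        obtain K where K: "\<And>g. \<bar>?A g \<bullet> f n\<bar> \<le> K * norm g" using fS by (auto simp: S_def)
        have "bounded_linear (\<lambda>g. ?A g \<bullet> f n)"
          by (rule bounded_linear_intro[where K = K])
             (use K in \<open>auto simp: add scale inner_add_left mult.commute\<close>)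
        then have "continuous_on UNIV (\<lambda>g. ?A g \<bullet> f n)" by (rule linear_continuous_on)
        then show "closed {g. \<bar>?A g \<bullet> f n\<bar> \<le> c}"
          by (intro closed_Collect_le continuous_on_rabs continuous_on_const)
      next
        fix g
        have "\<bar>?A g \<bullet> f n\<bar> \<le> norm (?A g) * M" for n
          using Cauchy_Schwarz_ineq2[of "?A g" "f n"] mult_left_mono[OF M[of n], of "norm (?A g)"] by simp
        then show "\<exists>K. \<forall>n\<in>UNIV. \<bar>?A g \<bullet> f n\<bar> \<le> K" by blast
      qed (auto simp: add scale inner_add_left abs_mult)
      have "\<bar>?A g \<bullet> f0\<bar> \<le> K * norm g" for g
      proof (rule LIMSEQ_le_const2)
        show "(\<lambda>n. \<bar>?A g \<bullet> f n\<bar>) \<longlonglongrightarrow> \<bar>?A g \<bullet> f0\<bar>" by (intro tendsto_intros lim)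
      qed (use K in auto)
      then show "f0 \<in> S" unfolding S_def by blast
    qed
    fix u assume u: "\<And>v. v \<in> S \<Longrightarrow> u \<bullet> v = 0"
    have "feature evk k x \<in> S" for x
    proof -
      obtain K where "\<And>g. \<bar>LINT y|\<kappa> x. evl g y\<bar> \<le> K * norm g"
        using rkhs_integral_bounded[OF rl int] by blast
      then show ?thesis
        unfolding S_def by (auto simp: reproducing[OF rk, symmetric] ev)
    qed
    then have "evk u x = 0" for x using u by (simp add: reproducing[OF rk])
    then show "u = 0"
      by (intro rkhs_eqI[OF rk]) (simp add: linear_0[OF rkhs_linear[OF rk]])
  qed
  have "\<exists>u. \<forall>g. ?A g \<bullet> f = g \<bullet> u" for f
  proof -
    obtain K where K: "\<And>g. \<bar>?A g \<bullet> f\<bar> \<le> K * norm g" using \<open>S = UNIV\<close> by (auto simp: S_def)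
    have "bounded_linear (\<lambda>g. ?A g \<bullet> f)"
      by (rule bounded_linear_intro[where K = K])
         (use K in \<open>auto simp: add scale inner_add_left mult.commute\<close>)
    then show ?thesis by (metis Riesz_representation)
  qed
  then obtain T where T: "\<forall>g f. ?A g \<bullet> f = g \<bullet> T f" by metis
  show "?A g \<bullet> f = g \<bullet> cond_mean_op evk evl \<kappa> f" for g f
    unfolding cond_mean_op_def adjoint_unique[OF T] using T by simp
qed

theorem theorem3p5:
  fixes P Q :: "'w measure"
    and X :: "'w \<Rightarrow> 'x::topological_space"
    and N :: "'y measure"
    and Y Z :: "'w \<Rightarrow> 'y"
    and \<alpha> kmax \<gamma> s s' :: real
    and k :: "'x \<Rightarrow> 'x \<Rightarrow> real"
    and l :: "'y \<Rightarrow> 'y \<Rightarrow> real"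
    and evk :: "'h::{real_inner,banach,second_countable_topology} \<Rightarrow> 'x \<Rightarrow> real"
    and evl :: "'g::{real_inner,banach} \<Rightarrow> 'y \<Rightarrow> real"
    and \<kappa>P \<kappa>Q :: "'x \<Rightarrow> 'y measure"
  defines "R \<equiv> mixture \<alpha> (distr P borel X) (distr Q borel X)"
  defines "C \<equiv> cov_op evk k R"
  assumes "prob_space P" and "prob_space Q" and "sets P = sets Q"
    and "space N = UNIV"
    and "X \<in> measurable P borel" and "Y \<in> measurable P N" and "Z \<in> measurable Q N"
    and "full_support (distr P borel X)" and "full_support (distr Q borel X)"
    and "absolutely_continuous (distr P borel X) (distr Q borel X)"
    and "absolutely_continuous (distr Q borel X) (distr P borel X)"
    and "0 \<le> \<alpha>" and "\<alpha> \<le> 1"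
    and "positive_definite_kernel k"
    and "(\<lambda>(x, x'). k x x') \<in> borel_measurable (borel \<Otimes>\<^sub>M borel)"
    and "continuous_on UNIV (\<lambda>(x, x'). k x x')"
    and "\<And>x. k x x \<le> kmax"
    and "is_rkhs evk k"
    and "positive_definite_kernel l"
    and "(\<lambda>(y, y'). l y y') \<in> borel_measurable (N \<Otimes>\<^sub>M N)"
    and "is_rkhs evl l"
    and "characteristic_on N evl"
    and "is_cond_distr P X N Y \<kappa>P" and "is_cond_distr Q X N Z \<kappa>Q"
    and "1 / 2 \<le> \<gamma>"
    and "cond_means_in_range evk evl \<kappa>P C \<gamma>" and "cond_means_in_range evk evl \<kappa>Q C \<gamma>"
    and "0 \<le> s'" and "s' \<le> s"
  shows "CMMD_sq evk evl C \<kappa>P \<kappa>Q s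
           \<le> largest_eigenvalue C powr (s - s') * CMMD_sq evk evl C \<kappa>P \<kappa>Q s'"
proof -
  have "X \<in> measurable Q borel"
    using assms measurable_cong_sets by blast
  then have "prob_space R"
    unfolding R_def using assms by (intro prob_space_mixture prob_space.prob_space_distr) simp_all
  moreover have "sets R = sets borel" by (simp add: R_def)
  ultimately interpret positive_trace_class C kmax
    unfolding C_def by (rule positive_trace_class_cov_op[OF \<open>is_rkhs evk k\<close>
      \<open>continuous_on UNIV (\<lambda>(x, x'). k x x')\<close> \<open>\<And>x. k x x \<le> kmax\<close>])
  let ?TP = "cond_mean_op evk evl \<kappa>P" and ?TQ = "cond_mean_op evk evl \<kappa>Q"
  have \<gamma>: "0 < \<gamma>" using \<open>1 / 2 \<le> \<gamma>\<close> by simp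
  have adjP: "cond_mean_op_adj evk evl \<kappa>P g \<bullet> f = g \<bullet> ?TP f"
    and adjQ: "cond_mean_op_adj evk evl \<kappa>Q g \<bullet> f = g \<bullet> ?TQ f" for f g
    using assms by (auto intro: inner_cond_mean_op)
  \<comment> \<open>Both operators have everywhere defined adjoints, hence are bounded.\<close>
  have D: "bounded_linear (\<lambda>f. ?TP f - ?TQ f)"
    by (intro bounded_linear_sub Hellinger_Toeplitz[OF adjP] Hellinger_Toeplitz[OF adjQ])
  \<comment> \<open>The range assumption turns into decay of \<open>?TP b\<close> in the eigenvalue
    of \<open>b\<close>; likewise for \<open>?TQ\<close>, and the two bounds add up for the
    difference.\<close>
  obtain LP where LP: "\<And>b. b \<in> eigvecs \<Longrightarrow> norm (?TP b) \<le> LP * eigval b powr \<gamma>"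
    by (rule norm_adjoint_eigvecs_le[OF adjP _ \<gamma>]) (use assms in \<open>blast intro: cond_mean_op_adj_in_range\<close>)+
  obtain LQ where LQ: "\<And>b. b \<in> eigvecs \<Longrightarrow> norm (?TQ b) \<le> LQ * eigval b powr \<gamma>"
    by (rule norm_adjoint_eigvecs_le[OF adjQ _ \<gamma>]) (use assms in \<open>blast intro: cond_mean_op_adj_in_range\<close>)+
  have "norm (?TP b - ?TQ b) \<le> (LP + LQ) * eigval b powr \<gamma>" if "b \<in> eigvecs" for b
    using norm_triangle_ineq4[of "?TP b" "?TQ b"] LP[OF that] LQ[OF that] by (simp add: distrib_right)
  from hs_norm_comp_op_powr_le[OF D \<open>1 / 2 \<le> \<gamma>\<close> \<open>0 \<le> s'\<close> \<open>s' \<le> s\<close> this] show ?thesis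
    unfolding CMMD_sq_def .
qed

end
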